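(* Let $p\in(0,1)$, $s:=\frac1p-1$, let $\boldsymbol\omega\in(0,\infty)^{\mathbb N^M}$ satisfy the weight conditions in the context, and for $\gamma>0$ let $r(\gamma):=\gamma^{-1/s}$. Let $\mathcal M^1_\gamma$ and $\mathcal M^2_\gamma$ be the model classes defined in the context. Then for all $\gamma>0$ and all $z\in\mathcal S=\{z\in L^2(\mu):\hat{\boldsymbol z}\in\ell^p_{\boldsymbol\omega^{(2-p)/p}}\}$ $$\inf_{v\in\mathcal M^2_\gamma}\|z-v\|_{L^\infty(\mu)}\le\inf_{v\in\mathcal M^1_\gamma}\|z-v\|_{L^\infty(\mu)}\le C\,\gamma\,\|z\|_{\mathcal S},\qquad C:=\Big\|\frac{\underline{\boldsymbol\omega}}{\boldsymbol\omega}\Big\|_{\ell^\infty},$$ where $\|z\|_{\mathcal S}:=\|\hat{\boldsymbol z}\|_{\ell^p_{\boldsymbol\omega^{(2-p)/p}}}$.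
   Context: $\mathbb N=\{0,1,2,\dots\}$, $M\ge1$, $U=[-1,1]^M$, $\mu$ is the uniform probability measure on $U$. $L_k$ are the univariate Legendre polynomials, orthonormal in $L^2$ of the uniform probability measure on $[-1,1]$; $L_{\boldsymbol\nu}(\boldsymbol y)=\prod_{k=1}^M L_{\boldsymbol\nu_k}(\boldsymbol y_k)$. A function $z\in L^2(\mu)$ is identified with its Legendre coefficients $\hat{\boldsymbol z}_{\boldsymbol\nu}=\int zL_{\boldsymbol\nu}\,\mathrm d\mu$. Operations and powers of sequences are elementwise; $\|\boldsymbol x\|_{\ell^p_{\boldsymbol\omega}}:=\|\boldsymbol\omega\boldsymbol x\|_{\ell^p}$ and $\|\boldsymbol x\|_{\ell^0_{\boldsymbol\omega}}:=\sum_{\boldsymbol\nu\in\operatorname{supp}\boldsymbol x}\boldsymbol\omega_{\boldsymbol\nu}^2$. Weights. $\underline{\boldsymbol\omega}_{\boldsymbol\nu}:=\|L_{\boldsymbol\nu}\|_{L^\infty(\mu)}=\prod_{k=1}^M(2\boldsymbol\nu_k+1)^{1/2}$; for a given $\boldsymbol\rho\in(1,\infty)^M$, $\bar{\boldsymbol\omega}_{\boldsymbol\nu}:=\prod_{k=1}^M(2\boldsymbol\nu_k+1)^{-1/2}\boldsymbol\rho_k^{\boldsymbol\nu_k}$. The weight $\boldsymbol\omega$ is assumed to satisfy $\underline{\boldsymbol\omega}^2/\boldsymbol\omega\in\ell^1$, $\boldsymbol\omega^{(2-p)/p}/\bar{\boldsymbol\omega}\in\ell^1$ and $\|\underline{\boldsymbol\omega}/\boldsymbol\omega\|_{\ell^\infty}\le1$.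 Truncation. For each $\gamma$, coefficient tensors in the model classes are supported on $\{0,\dots,N\}^M$, with $N\in\mathbb N$ chosen so that $N\ge(r(\gamma)-1)/2$. Mode sizes are $d_1=\dots=d_M=N+1$, and tensors in $\mathbb R^{d_1\times\cdots\times d_M}$ are identified with vectors and extended by zero to $\mathbb N^M$; $\boldsymbol\omega$ is restricted accordingly. Tensor notation. $\circ$ is contraction of the last mode of the left tensor with the first mode of the right one. A binary tensor $U^{(j)}\in\{0,1\}^{r_{j-1}\times d_j\times r_j}$ is left-orthogonal if its reshaping to an $(r_{j-1}d_j)\times r_j$ matrix has orthonormal columns; $V^{(j)}$ is right-orthogonal if its reshaping to an $r_{j-1}\times(d_jr_j)$ matrix has orthonormal rows; a tensor is $k$-sparse if it has at most $k$ nonzero entries; $r_0=r_M=1$. Class 1. For $m\in\{1,\dots,M\}$ let $\mathcal Q^1_{m}$ be the set of matrices $Q=\mathbf U\otimes I_{d_m}\otimes\mathbf V^{\top}$, where $\mathbf U$ is the $(d_1\cdots d_{m-1})\times r_{m-1}$ matricization of $U^{(1)}\circ\cdots\circ U^{(m-1)}$ and $\mathbf V$ is the $r_m\times(d_{m+1}\cdots d_M)$ matricization of $V^{(m+1)}\circ\cdots\circ V^{(M)}$ (both equal to $1$ for empty products), all $U^{(j)},V^{(j)}$ are binary tensors in $\{0,1\}^{r_{j-1}\times d_j\times r_j}$, the $U^{(j)}$ are left-orthogonal and $r_j$-sparse, and the $V^{(j)}$ are right-orthogonal and $r_{j-1}$-sparse, with arbitrary (unbounded) ranks $r_j$. Set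 $\mathcal M^1_{\infty,r,\boldsymbol\omega}:=\bigcap_{m=1}^M\bigcup_{Q\in\mathcal Q^1_m}\{QC: C\in\mathbb R^{r_{m-1}\times d_m\times r_m},\ \|C\|_{\ell^0_{Q^\top\boldsymbol\omega}}\le r\}$. Class 2. A matrix $Q$ is $\boldsymbol\omega^2$-orthogonal if $Q^\top\operatorname{diag}(\boldsymbol\omega^2)Q$ is diagonal. For $m\in\{1,\dots,M\}$ let $\mathcal Q^2_m$ be the set of linear maps $Q:\mathbb R^{r_{m-1}\times d_m\times r_m}\to\mathbb R^{d_1\times\cdots\times d_M}$ (arbitrary ranks) which are orthogonal ($Q^\top Q=I$) and $\boldsymbol\omega^2$-orthogonal, and let $\boldsymbol\omega_Q^2:=\operatorname{diag}(Q^\top\operatorname{diag}(\boldsymbol\omega^2)Q)$. Set $\mathcal M^2_{\infty,r,\boldsymbol\omega}:=\bigcap_{m=1}^M\bigcup_{Q\in\mathcal Q^2_m}\{QC:\|C\|_{\ell^0_{\boldsymbol\omega_Q}}\le r\}$. Finally $\mathcal M^{i}_\gamma:=\{v\in\mathcal S:\hat{\boldsymbol v}\in\mathcal M^{i}_{\infty,r(\gamma),\boldsymbol\omega}\}$ for $i=1,2$. *)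

theory Defs
  imports
    "HOL-Probability.Probability"
    "HOL-Probability.Essential_Supremum"
    "HOL-Computational_Algebra.Polynomial"
begin

section \<open>The cube, Legendre polynomials and Legendre coefficients\<close>

text \<open>Points of the cube and multi-indices are extensional functions on \<open>{1..M}\<close>; sequences
  indexed by multi-indices are extensional functions on \<open>multi_index M\<close>.\<close>

type_synonym point = "nat \<Rightarrow> real"
type_synonym mindex = "nat \<Rightarrow> nat"

definition cube :: "nat \<Rightarrow> point set" where
  "cube M = {1..M} \<rightarrow>\<^sub>E {-1..1}"

definition cube_measure :: "nat \<Rightarrow> point measure" where
  "cube_measure M = uniform_measure (Pi\<^sub>M {1..M} (\<lambda>_. lborel)) (cube M)"

definition multi_index :: "nat \<Rightarrow> mindex set" where
  "multi_index M = {1..M} \<rightarrow>\<^sub>E UNIV"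

text \<open>Rodrigues' formula, scaled by \<open>sqrt (2 * k + 1)\<close> so that the polynomials are orthonormal for
  the probability measure \<open>dx / 2\<close> on \<open>{-1..1}\<close>.\<close>

definition legendre_poly :: "nat \<Rightarrow> real poly" where
  "legendre_poly k =
     smult (sqrt (2 * real k + 1) / (2 ^ k * fact k)) ((pderiv ^^ k) ([:-1, 0, 1:] ^ k))"

definition legendre :: "nat \<Rightarrow> mindex \<Rightarrow> point \<Rightarrow> real" where
  "legendre M \<nu> y = (\<Prod>k=1..M. poly (legendre_poly (\<nu> k)) (y k))"

definition L2 :: "nat \<Rightarrow> (point \<Rightarrow> real) set" where
  "L2 M = {z \<in> borel_measurable (cube_measure M). integrable (cube_measure M) (\<lambda>y. (z y)\<^sup>2)}"

definition Linf_norm :: "nat \<Rightarrow> (point \<Rightarrow> real) \<Rightarrow> ennreal" where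
  "Linf_norm M f = esssup (cube_measure M) (\<lambda>y. ennreal \<bar>f y\<bar>)"

definition legendre_coeff :: "nat \<Rightarrow> (point \<Rightarrow> real) \<Rightarrow> mindex \<Rightarrow> real" where
  "legendre_coeff M z = (\<lambda>\<nu>\<in>multi_index M. LINT y|cube_measure M. z y * legendre M \<nu> y)"


section \<open>Sequence spaces and weights\<close>

definition in_lp :: "'i set \<Rightarrow> real \<Rightarrow> ('i \<Rightarrow> real) \<Rightarrow> bool" where
  "in_lp I p x \<longleftrightarrow> (\<lambda>\<nu>. \<bar>x \<nu>\<bar> powr p) summable_on I"

definition lp_norm :: "'i set \<Rightarrow> real \<Rightarrow> ('i \<Rightarrow> real) \<Rightarrow> real" where
  "lp_norm I p x = (\<Sum>\<^sub>\<infinity>\<nu>\<in>I. \<bar>x \<nu>\<bar> powr p) powr (1 / p)"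

definition linf_norm :: "'i set \<Rightarrow> ('i \<Rightarrow> real) \<Rightarrow> ennreal" where
  "linf_norm I x = (SUP \<nu>\<in>I. ennreal \<bar>x \<nu>\<bar>)"

text \<open>The weighted sparsity \<open>l\<^sup>0\<close>, used only for finite index sets.\<close>

definition weighted_l0 :: "'i set \<Rightarrow> ('i \<Rightarrow> real) \<Rightarrow> ('i \<Rightarrow> real) \<Rightarrow> real" where
  "weighted_l0 I w x = (\<Sum>\<nu>\<in>{\<nu>\<in>I. x \<nu> \<noteq> 0}. (w \<nu>)\<^sup>2)"

text \<open>This equals \<open>\<Prod>k=1..M. sqrt (2 * \<nu> k + 1)\<close>; in particular it is finite.\<close>

definition omega_low :: "nat \<Rightarrow> mindex \<Rightarrow> real" where
  "omega_low M \<nu> = enn2real (Linf_norm M (legendre M \<nu>))"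

definition omega_up :: "nat \<Rightarrow> (nat \<Rightarrow> real) \<Rightarrow> mindex \<Rightarrow> real" where
  "omega_up M \<rho> \<nu> = (\<Prod>k=1..M. (2 * real (\<nu> k) + 1) powr (-1/2) * \<rho> k ^ \<nu> k)"

definition S_space :: "nat \<Rightarrow> real \<Rightarrow> (mindex \<Rightarrow> real) \<Rightarrow> (point \<Rightarrow> real) set" where
  "S_space M p \<omega> =
     {z \<in> L2 M. in_lp (multi_index M) p (\<lambda>\<nu>. \<omega> \<nu> powr ((2 - p) / p) * legendre_coeff M z \<nu>)}"

definition S_norm :: "nat \<Rightarrow> real \<Rightarrow> (mindex \<Rightarrow> real) \<Rightarrow> (point \<Rightarrow> real) \<Rightarrow> real" where
  "S_norm M p \<omega> z =
     lp_norm (multi_index M) p (\<lambda>\<nu>. \<omega> \<nu> powr ((2 - p) / p) * legendre_coeff M z \<nu>)"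


section \<open>Tensors\<close>

text \<open>All modes have size \<open>d\<close>, and every index of a tensor starts at \<open>0\<close>, whereas the modes
  themselves are numbered \<open>1, \<dots>, M\<close>.\<close>

type_synonym tensor3 = "nat \<times> nat \<times> nat \<Rightarrow> real"

definition full_idx :: "nat \<Rightarrow> nat \<Rightarrow> mindex set" where
  "full_idx M d = {1..M} \<rightarrow>\<^sub>E {..<d}"

definition core_idx :: "nat \<Rightarrow> nat \<Rightarrow> nat \<Rightarrow> (nat \<times> nat \<times> nat) set" where
  "core_idx a d b = {..<a} \<times> {..<d} \<times> {..<b}"

definition binary_core :: "nat \<Rightarrow> nat \<Rightarrow> nat \<Rightarrow> tensor3 \<Rightarrow> bool" where
  "binary_core a d b T \<longleftrightarrow> (\<forall>c\<in>core_idx a d b. T c \<in> {0, 1})"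

definition left_orthogonal :: "nat \<Rightarrow> nat \<Rightarrow> nat \<Rightarrow> tensor3 \<Rightarrow> bool" where
  "left_orthogonal a d b T \<longleftrightarrow>
     (\<forall>l<b. \<forall>l'<b. (\<Sum>k<a. \<Sum>j<d. T (k, j, l) * T (k, j, l')) = (if l = l' then 1 else 0))"

definition right_orthogonal :: "nat \<Rightarrow> nat \<Rightarrow> nat \<Rightarrow> tensor3 \<Rightarrow> bool" where
  "right_orthogonal a d b T \<longleftrightarrow>
     (\<forall>k<a. \<forall>k'<a. (\<Sum>j<d. \<Sum>l<b. T (k, j, l) * T (k', j, l)) = (if k = k' then 1 else 0))"

definition sparse_core :: "nat \<Rightarrow> nat \<Rightarrow> nat \<Rightarrow> nat \<Rightarrow> tensor3 \<Rightarrow> bool" where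
  "sparse_core n a d b T \<longleftrightarrow> card {c \<in> core_idx a d b. T c \<noteq> 0} \<le> n"

text \<open>\<open>contract_chain r T a n k i l\<close> is the entry at position
  \<open>(k, i (a+1), \<dots>, i (a+n), l)\<close> of the contraction of \<open>T (a+1), \<dots>, T (a+n)\<close>, where \<open>T j\<close> has
  shape \<open>r (j-1) \<times> d \<times> r j\<close>. The empty contraction is the identity matrix of size \<open>r a\<close>, which is
  the scalar \<open>1\<close> in the only cases used below (\<open>a = 0\<close> or \<open>a = M\<close>, with \<open>r 0 = r M = 1\<close>).\<close>

fun contract_chain ::
  "(nat \<Rightarrow> nat) \<Rightarrow> (nat \<Rightarrow> tensor3) \<Rightarrow> nat \<Rightarrow> nat \<Rightarrow> nat \<Rightarrow> mindex \<Rightarrow> nat \<Rightarrow> real" where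
  "contract_chain r T a 0 k i l = (if k = l then 1 else 0)"
| "contract_chain r T a (Suc n) k i l =
     (\<Sum>h<r (a + n). contract_chain r T a n k i h * T (a + Suc n) (h, i (a + Suc n), l))"

text \<open>A linear map from tensors of shape \<open>a \<times> d \<times> b\<close> to tensors of order \<open>M\<close> is given by its
  matrix, with rows in \<open>full_idx M d\<close> and columns in \<open>core_idx a d b\<close>. Since \<open>a\<close> and \<open>b\<close> are
  arbitrary, they are kept along with the matrix.\<close>

type_synonym core_matrix = "mindex \<Rightarrow> nat \<times> nat \<times> nat \<Rightarrow> real"

text \<open>The image tensor, extended by zero from \<open>full_idx M d\<close> to \<open>multi_index M\<close>.\<close>

definition apply_matrix ::
  "nat \<Rightarrow> nat \<Rightarrow> nat \<Rightarrow> nat \<Rightarrow> core_matrix \<Rightarrow> tensor3 \<Rightarrow> mindex \<Rightarrow> real" where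
  "apply_matrix M d a b Q C =
     (\<lambda>i\<in>multi_index M. if i \<in> full_idx M d then \<Sum>c\<in>core_idx a d b. Q i c * C c else 0)"

definition transpose_apply :: "nat \<Rightarrow> nat \<Rightarrow> core_matrix \<Rightarrow> (mindex \<Rightarrow> real) \<Rightarrow> tensor3" where
  "transpose_apply M d Q x = (\<lambda>c. \<Sum>i\<in>full_idx M d. Q i c * x i)"

text \<open>The entry \<open>(c, c')\<close> of \<open>Q\<^sup>T diag(w) Q\<close>.\<close>

definition gram :: "nat \<Rightarrow> nat \<Rightarrow> (mindex \<Rightarrow> real) \<Rightarrow> core_matrix \<Rightarrow>
    nat \<times> nat \<times> nat \<Rightarrow> nat \<times> nat \<times> nat \<Rightarrow> real" where
  "gram M d w Q c c' = (\<Sum>i\<in>full_idx M d. Q i c * w i * Q i c')"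

definition admissible_ranks :: "nat \<Rightarrow> (nat \<Rightarrow> nat) \<Rightarrow> bool" where
  "admissible_ranks M r \<longleftrightarrow> r 0 = 1 \<and> r M = 1 \<and> (\<forall>j\<le>M. 1 \<le> r j)"


section \<open>The model classes\<close>

definition Q1 :: "nat \<Rightarrow> nat \<Rightarrow> nat \<Rightarrow> (nat \<times> nat \<times> core_matrix) set" where
  "Q1 M d m = {(r (m - 1), r m, Q) | r Q. admissible_ranks M r \<and>
     (\<exists>U V.
        (\<forall>j\<in>{1..<m}. binary_core (r (j - 1)) d (r j) (U j) \<and>
                     left_orthogonal (r (j - 1)) d (r j) (U j) \<and>
                     sparse_core (r j) (r (j - 1)) d (r j) (U j)) \<and>
        (\<forall>j\<in>{m<..M}. binary_core (r (j - 1)) d (r j) (V j) \<and>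
                     right_orthogonal (r (j - 1)) d (r j) (V j) \<and>
                     sparse_core (r (j - 1)) (r (j - 1)) d (r j) (V j)) \<and>
        Q = (\<lambda>i (k, j, l). contract_chain r U 0 (m - 1) 0 i k * (if i m = j then 1 else 0) *
                           contract_chain r V m (M - m) l i 0))}"

definition model1 :: "nat \<Rightarrow> nat \<Rightarrow> real \<Rightarrow> (mindex \<Rightarrow> real) \<Rightarrow> (mindex \<Rightarrow> real) set" where
  "model1 M d R \<omega> = (\<Inter>m\<in>{1..M}. \<Union>(a, b, Q)\<in>Q1 M d m.
     {apply_matrix M d a b Q C | C. weighted_l0 (core_idx a d b) (transpose_apply M d Q \<omega>) C \<le> R})"

definition Q2 ::
  "nat \<Rightarrow> nat \<Rightarrow> (mindex \<Rightarrow> real) \<Rightarrow> nat \<Rightarrow> (nat \<times> nat \<times> core_matrix) set" where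
  "Q2 M d \<omega> m = {(r (m - 1), r m, Q) | r Q. admissible_ranks M r \<and>
     (\<forall>c\<in>core_idx (r (m - 1)) d (r m). \<forall>c'\<in>core_idx (r (m - 1)) d (r m).
        gram M d (\<lambda>_. 1) Q c c' = (if c = c' then 1 else 0) \<and>
        (c \<noteq> c' \<longrightarrow> gram M d (\<lambda>i. (\<omega> i)\<^sup>2) Q c c' = 0))}"

definition omega_Q :: "nat \<Rightarrow> nat \<Rightarrow> (mindex \<Rightarrow> real) \<Rightarrow> core_matrix \<Rightarrow> tensor3" where
  "omega_Q M d \<omega> Q = (\<lambda>c. sqrt (gram M d (\<lambda>i. (\<omega> i)\<^sup>2) Q c c))"

definition model2 :: "nat \<Rightarrow> nat \<Rightarrow> real \<Rightarrow> (mindex \<Rightarrow> real) \<Rightarrow> (mindex \<Rightarrow> real) set" where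
  "model2 M d R \<omega> = (\<Inter>m\<in>{1..M}. \<Union>(a, b, Q)\<in>Q2 M d \<omega> m.
     {apply_matrix M d a b Q C | C. weighted_l0 (core_idx a d b) (omega_Q M d \<omega> Q) C \<le> R})"

definition rate :: "real \<Rightarrow> real" where
  "rate p = 1 / p - 1"

definition radius :: "real \<Rightarrow> real \<Rightarrow> real" where
  "radius p \<gamma> = \<gamma> powr (- 1 / rate p)"

definition model1_fun ::
  "nat \<Rightarrow> real \<Rightarrow> (mindex \<Rightarrow> real) \<Rightarrow> (real \<Rightarrow> nat) \<Rightarrow> real \<Rightarrow> (point \<Rightarrow> real) set" where
  "model1_fun M p \<omega> N \<gamma> =
     {v \<in> S_space M p \<omega>. legendre_coeff M v \<in> model1 M (N \<gamma> + 1) (radius p \<gamma>) \<omega>}"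

definition model2_fun ::
  "nat \<Rightarrow> real \<Rightarrow> (mindex \<Rightarrow> real) \<Rightarrow> (real \<Rightarrow> nat) \<Rightarrow> real \<Rightarrow> (point \<Rightarrow> real) set" where
  "model2_fun M p \<omega> N \<gamma> =
     {v \<in> S_space M p \<omega>. legendre_coeff M v \<in> model2 M (N \<gamma> + 1) (radius p \<gamma>) \<omega>}"

end

theory Submission
  imports Defs
begin

text \<open>
  The second class contains the first one because binary orthogonal cores are extremely rigid: a binary
  column of norm 1 is a unit vector, and orthogonal unit vectors are distinct. Every matrix \<open>Q\<close> of the
  first class is thus an injective relabelling of core positions as multi-indices
  (\<open>Q1_unit_columns\<close>). Such a matrix is orthogonal and \<open>\<omega>\<^sup>2\<close>-orthogonal, and the weights
  \<open>Q\<^sup>T \<omega>\<close> and \<open>\<omega>\<^sub>Q\<close> coincide (\<open>Q1_subset_Q2\<close>).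

  Conversely, with maximal ranks the relabelling is a bijection for every mode \<open>m\<close>. Hence the first class
  contains every tensor on the truncated index set whose support \<open>\<Lambda>\<close> satisfies
  \<open>\<Sum>\<nu>\<in>\<Lambda>. \<omega>\<^sub>\<nu>\<^sup>2 \<le> r\<close> (\<open>sparse_tensor_in_model1\<close>). The truncation is harmless: the Legendre
  polynomials take the value \<open>sqrt (2 k + 1)\<close> at \<open>1\<close>, so \<open>2 \<nu>\<^sub>k + 1 \<le> \<omega>\<^sub>\<nu>\<^sup>2 \<le> r\<close> for
  \<open>\<nu> \<in> \<Lambda>\<close> (\<open>omega_low_square_ge\<close>), which is the condition on \<open>N\<close>.

  The approximation error is thereby reduced to sparse approximation of the coefficients \<open>c\<close> of \<open>z\<close>.
  With the values \<open>\<bar>c\<^sub>\<nu>\<bar> / \<omega>\<^sub>\<nu>\<close> and the masses \<open>\<omega>\<^sub>\<nu>\<^sup>2\<close>, the norm of \<open>z\<close> is an \<open>\<ell>\<^sup>p\<close> norm and the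
  weighted sum of the discarded coefficients is an \<open>\<ell>\<^sup>1\<close> norm, so a weighted Stechkin inequality
  (\<open>weighted_stechkin\<close>) bounds the latter by \<open>r powr (1 - 1 / p)\<close>, that is by \<open>\<gamma>\<close>, times the norm.
  As \<open>\<bar>L\<^sub>\<nu>\<bar>\<close> is at most \<open>C \<omega>\<^sub>\<nu>\<close>, this tail dominates the sup norm of the remainder of the Legendre
  series of \<open>z\<close>. The series represents \<open>z\<close> almost everywhere because the Legendre polynomials are
  orthonormal and complete (\<open>legendre_series_represents\<close>).
\<close>

section \<open>The weighted Stechkin inequality\<close>

lemma finite_has_maximal_idx:
  fixes f :: "'i \<Rightarrow> 'a::linorder"
  assumes "finite K" "K \<noteq> {}"
  shows "\<exists>b\<in>K. \<forall>i\<in>K. f i \<le> f b"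
proof -
  have "Max (f ` K) \<in> f ` K" using assms by (intro Max_in) auto
  then obtain b where "b \<in> K" "f b = Max (f ` K)" by auto
  then show ?thesis using assms by (intro bexI[of _ b]) auto
qed

lemma finite_superlevel_summable:
  fixes g :: "'i \<Rightarrow> real"
  assumes "g summable_on I" "\<And>i. i \<in> I \<Longrightarrow> 0 \<le> g i" "0 < \<epsilon>"
  shows "finite {i\<in>I. \<epsilon> \<le> g i}"
proof -
  have "card F \<le> nat \<lceil>(\<Sum>\<^sub>\<infinity>i\<in>I. g i) / \<epsilon>\<rceil>" if F: "F \<subseteq> {i\<in>I. \<epsilon> \<le> g i}" "finite F" for F
  proof -
    have "real (card F) * \<epsilon> \<le> (\<Sum>i\<in>F. g i)"
      using F by (intro sum_bounded_below) auto
    also have "\<dots> \<le> (\<Sum>\<^sub>\<infinity>i\<in>I. g i)"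
      using assms F by (intro finite_sum_le_infsum) auto
    finally have "real (card F) \<le> (\<Sum>\<^sub>\<infinity>i\<in>I. g i) / \<epsilon>"
      using assms(3) by (simp add: field_simps)
    then show ?thesis by linarith
  qed
  then show ?thesis
    using finite_if_finite_subsets_card_bdd by (metis (no_types, lifting))
qed

text \<open>Best approximation in a weighted \<open>\<ell>\<^sup>1\<close> norm, with \<open>f\<close> the magnitudes and \<open>w\<close> the masses of the
  indices. Indices are taken greedily in decreasing order of \<open>f\<close> as long as the mass budget \<open>r\<close>
  allows. The first rejected index \<open>b\<close> overflows the budget, so
  \<open>r * f b powr p \<le> S = (\<Sum> f powr p * w)\<close>; all remaining values are at most \<open>f b\<close>, whence the
  rest is at most \<open>f b powr (1 - p) * S\<close>. Counting the mass of \<open>b\<close> itself is what gives the bound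
  with the constant 1 and without a correction for the size of the largest weight.\<close>
lemma weighted_stechkin:
  fixes f w :: "'i \<Rightarrow> real"
  assumes p: "0 < p" "p < 1" and r: "0 < r"
    and w: "\<And>i. i \<in> I \<Longrightarrow> 1 \<le> w i" and f: "\<And>i. i \<in> I \<Longrightarrow> 0 \<le> f i"
    and sm: "(\<lambda>i. f i powr p * w i) summable_on I"
  obtains \<Lambda> where "finite \<Lambda>" "\<Lambda> \<subseteq> I" "sum w \<Lambda> \<le> r"
    "(\<lambda>i. f i * w i) summable_on (I - \<Lambda>)"
    "(\<Sum>\<^sub>\<infinity>i\<in>I - \<Lambda>. f i * w i) \<le> r powr (1 - 1 / p) * (\<Sum>\<^sub>\<infinity>i\<in>I. f i powr p * w i) powr (1 / p)"
proof -
  define S where "S = (\<Sum>\<^sub>\<infinity>i\<in>I. f i powr p * w i)"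
  have nn: "0 \<le> f i powr p * w i" if "i \<in> I" for i
    using w[OF that] by auto
  have S0: "0 \<le> S" unfolding S_def using nn by (intro infsum_nonneg) auto
  define J where "J = {i\<in>I. 0 < f i}"
  define good where "good \<Lambda> \<longleftrightarrow> finite \<Lambda> \<and> \<Lambda> \<subseteq> J \<and> (\<forall>a\<in>\<Lambda>. \<forall>b\<in>J - \<Lambda>. f b \<le> f a) \<and> sum w \<Lambda> \<le> r" for \<Lambda>
  \<comment> \<open>The outcome of the greedy selection is a largest admissible set that is closed upwards.\<close>
  have "good {}" using r by (auto simp: good_def)
  moreover have "card \<Lambda> \<le> nat \<lceil>r\<rceil>" if "good \<Lambda>" for \<Lambda>
  proof -
    have "real (card \<Lambda>) * 1 \<le> sum w \<Lambda>"
      using that w by (intro sum_bounded_below) (auto simp: good_def J_def)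
    then show ?thesis using that unfolding good_def by linarith
  qed
  ultimately obtain \<Lambda> where \<Lambda>: "good \<Lambda>" and mx: "\<And>\<Lambda>'. good \<Lambda>' \<Longrightarrow> card \<Lambda>' \<le> card \<Lambda>"
    using ex_has_greatest_nat[of good "{}" card "Suc (nat \<lceil>r\<rceil>)"] by (metis le_imp_less_Suc)
  have upper: "f b \<le> f a" if "a \<in> \<Lambda>" "b \<in> J - \<Lambda>" for a b
    using \<Lambda> that unfolding good_def by blast
  have \<Lambda>'': "finite \<Lambda>" "\<Lambda> \<subseteq> J" "sum w \<Lambda> \<le> r"
    using \<Lambda> by (simp_all only: good_def)
  then have \<Lambda>': "finite \<Lambda>" "\<Lambda> \<subseteq> I" "sum w \<Lambda> \<le> r" "\<Lambda> \<subseteq> J"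
    by (auto simp: J_def)
  have sm': "(\<lambda>i. f i powr p * w i) summable_on (I - \<Lambda>)"
    using sm by (rule summable_on_subset) auto
  show ?thesis
  proof (cases "J - \<Lambda> = {}")
    case True
    then have z: "f i * w i = 0" if "i \<in> I - \<Lambda>" for i
      using f that by (force simp: J_def)
    have "(\<Sum>\<^sub>\<infinity>i\<in>I - \<Lambda>. f i * w i) = 0"
      by (rule infsum_0) (rule z)
    moreover have "(\<lambda>i. f i * w i) summable_on (I - \<Lambda>)"
      by (rule summable_on_0) (rule z)
    ultimately show ?thesis using \<Lambda>' that by simp
  next
    case False
    then obtain b0 where b0: "b0 \<in> J - \<Lambda>" by auto
    define K where "K = {i\<in>J - \<Lambda>. f b0 \<le> f i}"
    have "K \<subseteq> {i\<in>I. f b0 powr p \<le> f i powr p * w i}"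
    proof safe
      fix i assume i: "i \<in> K"
      then show I: "i \<in> I" by (auto simp: K_def J_def)
      have "f b0 powr p \<le> f i powr p * 1"
        using i b0 p by (auto simp: K_def J_def intro!: powr_mono2)
      also have "\<dots> \<le> f i powr p * w i" using w[OF I] by (intro mult_left_mono) auto
      finally show "f b0 powr p \<le> f i powr p * w i" .
    qed
    moreover have "finite {i\<in>I. f b0 powr p \<le> f i powr p * w i}"
      using b0 nn sm by (intro finite_superlevel_summable) (auto simp: J_def)
    ultimately have "finite K" by (rule finite_subset)
    moreover have "K \<noteq> {}" using b0 by (auto simp: K_def)
    ultimately obtain b where b: "b \<in> K" "\<And>i. i \<in> K \<Longrightarrow> f i \<le> f b"
      using finite_has_maximal_idx[of K f] by blast
    have bmax: "f i \<le> f b" if "i \<in> J - \<Lambda>" for i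
      using b(2)[of i] b(1) that by (cases "f b0 \<le> f i") (auto simp: K_def)
    have bJ: "b \<in> J" "b \<notin> \<Lambda>" "b \<in> I" "0 < f b" using b(1) by (auto simp: K_def J_def)
    \<comment> \<open>The set together with its best outside index is still closed upwards, so it must exceed the budget.\<close>
    have "\<not> good (insert b \<Lambda>)"
      using mx[of "insert b \<Lambda>"] \<Lambda>'(1) bJ by auto
    moreover have "\<forall>a\<in>insert b \<Lambda>. \<forall>c\<in>J - insert b \<Lambda>. f c \<le> f a"
      using bmax upper by auto
    ultimately have over: "r < sum w (insert b \<Lambda>)"
      using \<Lambda>' bJ unfolding good_def by (meson finite.insertI insert_subsetI not_le)
    have fb_le: "f b \<le> f a" if "a \<in> insert b \<Lambda>" for a
      using that bJ upper by auto
    have "f b powr p * r \<le> f b powr p * sum w (insert b \<Lambda>)"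
      using over by (intro mult_left_mono) auto
    also have "\<dots> = (\<Sum>i\<in>insert b \<Lambda>. f b powr p * w i)" by (rule sum_distrib_left)
    also have "\<dots> \<le> (\<Sum>i\<in>insert b \<Lambda>. f i powr p * w i)"
    proof (intro sum_mono mult_right_mono powr_mono2)
      fix i assume i: "i \<in> insert b \<Lambda>"
      then have "i \<in> I" using bJ \<Lambda>' by auto
      then show "0 \<le> w i" using w[of i] by auto
      show "f b \<le> f i" using fb_le[OF i] .
    qed (use p bJ in auto)
    also have "\<dots> \<le> S"
      unfolding S_def using sm nn \<Lambda>' bJ by (intro finite_sum_le_infsum) auto
    finally have fbS: "f b powr p * r \<le> S" .
    have "f b powr (1 - p) = (f b powr p) powr ((1 - p) / p)"
      using p by (simp add: powr_powr)
    also have "\<dots> \<le> (S / r) powr ((1 - p) / p)"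
      using fbS r p by (intro powr_mono2) (auto simp: field_simps)
    finally have fb: "f b powr (1 - p) \<le> (S / r) powr ((1 - p) / p)" .
    have le: "f i * w i \<le> (S / r) powr ((1 - p) / p) * (f i powr p * w i)" if i: "i \<in> I - \<Lambda>" for i
    proof (cases "i \<in> J")
      case True
      then have fi: "0 < f i" by (auto simp: J_def)
      have "f i * w i = f i powr (1 - p) * (f i powr p * w i)"
        using fi by (simp add: powr_diff)
      also have "f i powr (1 - p) \<le> f b powr (1 - p)"
        using bmax[of i] True i fi p by (intro powr_mono2) auto
      also note fb
      finally show ?thesis using nn i by (simp add: mult_right_mono)
    next
      case False
      then have "f i = 0" using f[of i] i by (force simp: J_def)
      then show ?thesis using p by simp
    qed
    have sm2: "(\<lambda>i. (S / r) powr ((1 - p) / p) * (f i powr p * w i)) summable_on (I - \<Lambda>)"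
      using sm' by (rule summable_on_cmult_right)
    have sm3: "(\<lambda>i. f i * w i) summable_on (I - \<Lambda>)"
    proof (rule summable_on_comparison_test[OF sm2])
      fix i assume i: "i \<in> I - \<Lambda>"
      then show "f i * w i \<le> (S / r) powr ((1 - p) / p) * (f i powr p * w i)" by (rule le)
      show "0 \<le> f i * w i" using f[of i] w[of i] i by (intro mult_nonneg_nonneg) auto
    qed
    have "(\<Sum>\<^sub>\<infinity>i\<in>I - \<Lambda>. f i * w i) \<le> (\<Sum>\<^sub>\<infinity>i\<in>I - \<Lambda>. (S / r) powr ((1 - p) / p) * (f i powr p * w i))"
      using sm2 sm3 le by (intro infsum_mono) auto
    also have "\<dots> = (S / r) powr ((1 - p) / p) * (\<Sum>\<^sub>\<infinity>i\<in>I - \<Lambda>. f i powr p * w i)"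
      by (rule infsum_cmult_right) (use sm' in auto)
    also have "\<dots> \<le> (S / r) powr ((1 - p) / p) * S"
      unfolding S_def using nn sm sm' by (intro mult_left_mono infsum_mono2) auto
    also have "\<dots> = r powr (1 - 1 / p) * S powr (1 / p)"
    proof -
      have e: "(1 - p) / p = 1 / p - 1" using p by (simp add: field_simps)
      have "S powr (1 / p - 1) * S = S powr (1 / p)"
        using S0 p by (cases "S = 0") (auto simp: powr_diff)
      moreover have "(S / r) powr (1 / p - 1) = S powr (1 / p - 1) * r powr (1 - 1 / p)"
      proof -
        have "r powr (1 - 1 / p) = 1 / r powr (1 / p - 1)"
          using powr_minus_divide[of r "1 / p - 1"] by simp
        then show ?thesis using S0 r by (simp only: powr_divide) simp
      qed
      ultimately show ?thesis unfolding e by (simp add: algebra_simps)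
    qed
    finally show ?thesis using \<Lambda>' sm3 that unfolding S_def by auto
  qed
qed

section \<open>Binary orthogonal cores and the model classes\<close>

lemma zero_one_unit_vector:
  fixes f :: "'a \<Rightarrow> real"
  assumes "finite S" "\<And>x. x \<in> S \<Longrightarrow> f x \<in> {0, 1}" "(\<Sum>x\<in>S. f x * f x) = 1"
  shows "\<exists>x0\<in>S. \<forall>x\<in>S. f x = of_bool (x = x0)"
proof -
  have "(\<Sum>x\<in>S. f x * f x) = (\<Sum>x\<in>S. of_bool (f x = 1))"
    using assms(2) by (intro sum.cong) auto
  also have "\<dots> = real (card {x\<in>S. f x = 1})"
    using assms(1) by (simp add: of_bool_def sum.If_cases Int_def)
  finally have "card {x\<in>S. f x = 1} = 1" using assms(3) by simp
  then obtain x0 where "{x\<in>S. f x = 1} = {x0}" by (auto simp: card_1_singleton_iff)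
  then show ?thesis using assms(2) by (intro bexI[of _ x0]) auto
qed

text \<open>A binary vector of norm 1 is a unit vector, and orthogonal unit vectors are distinct. Hence the
  columns of a binary left-orthogonal core are described by two index functions \<open>h\<close>, \<open>q\<close> that are
  jointly injective.\<close>
lemma left_orthogonal_binary_column:
  assumes "binary_core a d b T" "left_orthogonal a d b T"
  obtains h q where "\<And>l. l < b \<Longrightarrow> h l < a \<and> q l < d"
    "\<And>k j l. k < a \<Longrightarrow> j < d \<Longrightarrow> l < b \<Longrightarrow> T (k, j, l) = of_bool (k = h l \<and> j = q l)"
    "\<And>l l'. l < b \<Longrightarrow> l' < b \<Longrightarrow> h l = h l' \<Longrightarrow> q l = q l' \<Longrightarrow> l = l'"
proof -
  let ?S = "{..<a} \<times> {..<d}"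
  have gram: "(\<Sum>x\<in>?S. T (fst x, snd x, l) * T (fst x, snd x, l')) = of_bool (l = l')" if "l < b" "l' < b" for l l'
    using assms(2) that by (simp add: left_orthogonal_def sum.cartesian_product case_prod_beta)
  have "\<exists>x0\<in>?S. \<forall>x\<in>?S. T (fst x, snd x, l) = of_bool (x = x0)" if "l < b" for l
  proof (rule zero_one_unit_vector)
    show "T (fst x, snd x, l) \<in> {0, 1}" if "x \<in> ?S" for x
    proof -
      have "(fst x, snd x, l) \<in> core_idx a d b"
        using that \<open>l < b\<close> by (auto simp: core_idx_def)
      then show ?thesis using assms(1) unfolding binary_core_def by blast
    qed
  qed (use gram[of l l] that in auto)
  then obtain x0 where x0: "\<And>l. l < b \<Longrightarrow> x0 l \<in> ?S"
    "\<And>l x. l < b \<Longrightarrow> x \<in> ?S \<Longrightarrow> T (fst x, snd x, l) = of_bool (x = x0 l)"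
    by metis
  show ?thesis
  proof (rule that[of "\<lambda>l. fst (x0 l)" "\<lambda>l. snd (x0 l)"])
    fix l assume "l < b" then show "fst (x0 l) < a \<and> snd (x0 l) < d" using x0(1)[of l] by auto
  next
    fix k j l assume "k < a" "j < d" "l < b"
    then show "T (k, j, l) = of_bool (k = fst (x0 l) \<and> j = snd (x0 l))"
      using x0(2)[of l "(k, j)"] by (simp add: prod_eq_iff)
  next
    fix l l' assume l: "l < b" "l' < b" "fst (x0 l) = fst (x0 l')" "snd (x0 l) = snd (x0 l')"
    then have "x0 l = x0 l'" by (simp add: prod_eq_iff)
    then have "(\<Sum>x\<in>?S. T (fst x, snd x, l) * T (fst x, snd x, l')) = (\<Sum>x\<in>?S. T (fst x, snd x, l) * T (fst x, snd x, l))"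
      using x0(2) l by (intro sum.cong) auto
    then show "l = l'" using gram[OF l(1,2)] gram[OF l(1,1)] by (auto split: if_splits)
  qed
qed

lemma right_orthogonal_binary_row:
  assumes "binary_core a d b T" "right_orthogonal a d b T"
  obtains q h where "\<And>k. k < a \<Longrightarrow> q k < d \<and> h k < b"
    "\<And>k j l. k < a \<Longrightarrow> j < d \<Longrightarrow> l < b \<Longrightarrow> T (k, j, l) = of_bool (j = q k \<and> l = h k)"
    "\<And>k k'. k < a \<Longrightarrow> k' < a \<Longrightarrow> q k = q k' \<Longrightarrow> h k = h k' \<Longrightarrow> k = k'"
proof -
  define T' where "T' = (\<lambda>(l, j, k). T (k, j, l))"
  have "binary_core b d a T'"
    using assms(1) by (auto simp: binary_core_def core_idx_def T'_def)
  moreover have "left_orthogonal b d a T'"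
    using assms(2) unfolding left_orthogonal_def right_orthogonal_def T'_def
    by (subst sum.swap) simp
  ultimately obtain h q where "\<And>l. l < a \<Longrightarrow> h l < b \<and> q l < d"
    "\<And>k j l. k < b \<Longrightarrow> j < d \<Longrightarrow> l < a \<Longrightarrow> T' (k, j, l) = of_bool (k = h l \<and> j = q l)"
    "\<And>l l'. l < a \<Longrightarrow> l' < a \<Longrightarrow> h l = h l' \<Longrightarrow> q l = q l' \<Longrightarrow> l = l'"
    by (rule left_orthogonal_binary_column) blast
  then show ?thesis
    by (intro that[of q h]) (auto simp: T'_def)
qed

text \<open>The previous description survives contraction: column \<open>l\<close> of the next core picks column \<open>h l\<close> of
  the chain built so far and appends the entry \<open>q l\<close> to its multi-index, and \<open>(h, q)\<close> is injective.\<close>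
lemma left_chain_unit_columns:
  assumes "r 0 = 1"
    and "\<forall>j\<in>{1..n}. binary_core (r (j - 1)) d (r j) (U j) \<and> left_orthogonal (r (j - 1)) d (r j) (U j)"
  shows "\<exists>\<alpha>. (\<forall>l<r n. \<forall>j\<in>{1..n}. \<alpha> l j < d) \<and>
     (\<forall>l<r n. \<forall>i. (\<forall>j\<in>{1..n}. i j < d) \<longrightarrow>
        contract_chain r U 0 n 0 i l = of_bool (\<forall>j\<in>{1..n}. i j = \<alpha> l j)) \<and>
     (\<forall>l<r n. \<forall>l'<r n. (\<forall>j\<in>{1..n}. \<alpha> l j = \<alpha> l' j) \<longrightarrow> l = l')"
  using assms(2)
proof (induction n)
  case 0
  then show ?case using assms(1) by simp
next
  case (Suc n)
  obtain \<alpha> where \<alpha>: "\<And>l j. l < r n \<Longrightarrow> j \<in> {1..n} \<Longrightarrow> \<alpha> l j < d"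
    "\<And>l i. l < r n \<Longrightarrow> \<forall>j\<in>{1..n}. i j < d \<Longrightarrow>
        contract_chain r U 0 n 0 i l = of_bool (\<forall>j\<in>{1..n}. i j = \<alpha> l j)"
    "\<And>l l'. l < r n \<Longrightarrow> l' < r n \<Longrightarrow> \<forall>j\<in>{1..n}. \<alpha> l j = \<alpha> l' j \<Longrightarrow> l = l'"
  proof -
    have "\<forall>j\<in>{1..n}. binary_core (r (j - 1)) d (r j) (U j) \<and> left_orthogonal (r (j - 1)) d (r j) (U j)"
      using Suc.prems by auto
    from Suc.IH[OF this] show ?thesis using that by (elim exE conjE) blast
  qed
  have "binary_core (r n) d (r (Suc n)) (U (Suc n))" "left_orthogonal (r n) d (r (Suc n)) (U (Suc n))"
    using Suc.prems by (auto dest: bspec[of _ _ "Suc n"])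
  then obtain h q where hq: "\<And>l. l < r (Suc n) \<Longrightarrow> h l < r n \<and> q l < d"
    "\<And>k j l. k < r n \<Longrightarrow> j < d \<Longrightarrow> l < r (Suc n) \<Longrightarrow> U (Suc n) (k, j, l) = of_bool (k = h l \<and> j = q l)"
    "\<And>l l'. l < r (Suc n) \<Longrightarrow> l' < r (Suc n) \<Longrightarrow> h l = h l' \<Longrightarrow> q l = q l' \<Longrightarrow> l = l'"
    by (rule left_orthogonal_binary_column) blast
  have set: "{1..Suc n} = insert (Suc n) {1..n}" by auto
  show ?case
  proof (intro exI[of _ "\<lambda>l. (\<alpha> (h l))(Suc n := q l)"] conjI allI impI)
    fix l assume "l < r (Suc n)"
    then show "\<forall>j\<in>{1..Suc n}. ((\<alpha> (h l))(Suc n := q l)) j < d"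
      using hq(1)[of l] \<alpha>(1)[of "h l"] by (auto simp: set)
  next
    fix l and i :: mindex
    assume l: "l < r (Suc n)" and i: "\<forall>j\<in>{1..Suc n}. i j < d"
    have "contract_chain r U 0 (Suc n) 0 i l =
        (\<Sum>k<r n. if k = h l then contract_chain r U 0 n 0 i k * of_bool (i (Suc n) = q l) else 0)"
      using hq(2)[OF _ _ l] i by (auto intro!: sum.cong)
    also have "\<dots> = contract_chain r U 0 n 0 i (h l) * of_bool (i (Suc n) = q l)"
      using hq(1)[OF l] by simp
    also have "\<dots> = of_bool (\<forall>j\<in>{1..Suc n}. i j = ((\<alpha> (h l))(Suc n := q l)) j)"
      using \<alpha>(2)[of "h l" i] hq(1)[OF l] i by (auto simp: set)
    finally show "contract_chain r U 0 (Suc n) 0 i l = of_bool (\<forall>j\<in>{1..Suc n}. i j = ((\<alpha> (h l))(Suc n := q l)) j)" .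
  next
    fix l l' assume l: "l < r (Suc n)" "l' < r (Suc n)"
      and eq: "\<forall>j\<in>{1..Suc n}. ((\<alpha> (h l))(Suc n := q l)) j = ((\<alpha> (h l'))(Suc n := q l')) j"
    have "h l = h l'"
    proof (rule \<alpha>(3))
      show "\<forall>j\<in>{1..n}. \<alpha> (h l) j = \<alpha> (h l') j"
      proof
        fix j assume "j \<in> {1..n}"
        then show "\<alpha> (h l) j = \<alpha> (h l') j" using bspec[OF eq, of j] by simp
      qed
    qed (use l hq(1) in auto)
    moreover have "q l = q l'" using bspec[OF eq, of "Suc n"] by simp
    ultimately show "l = l'" using hq(3) l by blast
  qed
qed

text \<open>The counterpart for right-orthogonal cores. Since a chain grows at its right end, the induction
  carries along the rank index \<open>e k\<close> at which the \<open>k\<close>-th row ends; it becomes trivial for the full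
  chain, where the last rank is 1.\<close>
lemma right_chain_unit_rows:
  assumes "\<forall>j\<in>{m<..m + n}. binary_core (r (j - 1)) d (r j) (V j) \<and> right_orthogonal (r (j - 1)) d (r j) (V j)"
  shows "\<exists>\<beta> e. (\<forall>k<r m. e k < r (m + n) \<and> (\<forall>j\<in>{m<..m + n}. \<beta> k j < d)) \<and>
     (\<forall>k<r m. \<forall>l<r (m + n). \<forall>i. (\<forall>j\<in>{m<..m + n}. i j < d) \<longrightarrow>
        contract_chain r V m n k i l = of_bool ((\<forall>j\<in>{m<..m + n}. i j = \<beta> k j) \<and> l = e k)) \<and>
     (\<forall>k<r m. \<forall>k'<r m. (\<forall>j\<in>{m<..m + n}. \<beta> k j = \<beta> k' j) \<longrightarrow> e k = e k' \<longrightarrow> k = k')"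
  using assms
proof (induction n)
  case 0
  show ?case by (intro exI[of _ "\<lambda>_ _. 0"] exI[of _ "\<lambda>k. k"]) auto
next
  case (Suc n)
  have pr: "\<forall>j\<in>{m<..m + n}. binary_core (r (j - 1)) d (r j) (V j) \<and> right_orthogonal (r (j - 1)) d (r j) (V j)"
    using Suc.prems by auto
  obtain \<beta> e where IH: "\<forall>k<r m. e k < r (m + n) \<and> (\<forall>j\<in>{m<..m + n}. \<beta> k j < d)"
    "\<forall>k<r m. \<forall>l<r (m + n). \<forall>i. (\<forall>j\<in>{m<..m + n}. i j < d) \<longrightarrow>
        contract_chain r V m n k i l = of_bool ((\<forall>j\<in>{m<..m + n}. i j = \<beta> k j) \<and> l = e k)"
    "\<forall>k<r m. \<forall>k'<r m. (\<forall>j\<in>{m<..m + n}. \<beta> k j = \<beta> k' j) \<longrightarrow> e k = e k' \<longrightarrow> k = k'"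
    using Suc.IH[OF pr] by (elim exE conjE) (rule that; assumption)
  have \<beta>: "\<And>k. k < r m \<Longrightarrow> e k < r (m + n)"
    "\<And>k j. k < r m \<Longrightarrow> j \<in> {m<..m + n} \<Longrightarrow> \<beta> k j < d"
    using IH(1) by simp_all
  let ?s = "m + Suc n"
  have "binary_core (r (m + n)) d (r ?s) (V ?s)" "right_orthogonal (r (m + n)) d (r ?s) (V ?s)"
    using Suc.prems by (auto dest: bspec[of _ _ ?s])
  then obtain q h where qh: "\<And>k. k < r (m + n) \<Longrightarrow> q k < d \<and> h k < r ?s"
    "\<And>k j l. k < r (m + n) \<Longrightarrow> j < d \<Longrightarrow> l < r ?s \<Longrightarrow> V ?s (k, j, l) = of_bool (j = q k \<and> l = h k)"
    "\<And>k k'. k < r (m + n) \<Longrightarrow> k' < r (m + n) \<Longrightarrow> q k = q k' \<Longrightarrow> h k = h k' \<Longrightarrow> k = k'"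
    by (rule right_orthogonal_binary_row) blast
  have set: "{m<..?s} = insert ?s {m<..m + n}" by auto
  show ?case
  proof (intro exI[of _ "\<lambda>k. (\<beta> k)(?s := q (e k))"] exI[of _ "\<lambda>k. h (e k)"] conjI allI impI)
    fix k assume "k < r m"
    then show "h (e k) < r ?s" "\<forall>j\<in>{m<..?s}. ((\<beta> k)(?s := q (e k))) j < d"
      using qh(1) \<beta>(1,2) by (auto simp: set)
  next
    fix k l and i :: mindex
    assume k: "k < r m" and l: "l < r ?s" and i: "\<forall>j\<in>{m<..?s}. i j < d"
    have "contract_chain r V m (Suc n) k i l =
        (\<Sum>t<r (m + n). if t = e k then of_bool (\<forall>j\<in>{m<..m + n}. i j = \<beta> k j) * V ?s (e k, i ?s, l) else 0)"
      unfolding contract_chain.simps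
    proof (rule sum.cong)
      fix t assume "t \<in> {..<r (m + n)}"
      with k i have "contract_chain r V m n k i t = of_bool ((\<forall>j\<in>{m<..m + n}. i j = \<beta> k j) \<and> t = e k)"
        using IH(2) k i by simp
      then show "contract_chain r V m n k i t * V ?s (t, i ?s, l) =
          (if t = e k then of_bool (\<forall>j\<in>{m<..m + n}. i j = \<beta> k j) * V ?s (e k, i ?s, l) else 0)"
        by simp
    qed simp
    also have "\<dots> = of_bool (\<forall>j\<in>{m<..m + n}. i j = \<beta> k j) * V ?s (e k, i ?s, l)"
      using \<beta>(1)[OF k] by simp
    also have "\<dots> = of_bool ((\<forall>j\<in>{m<..?s}. i j = ((\<beta> k)(?s := q (e k))) j) \<and> l = h (e k))"
    proof -
      have "V ?s (e k, i ?s, l) = of_bool (i ?s = q (e k) \<and> l = h (e k))"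
        using qh(2)[OF \<beta>(1)[OF k] _ l, of "i ?s"] i by simp
      moreover have "(\<forall>j\<in>{m<..?s}. i j = ((\<beta> k)(?s := q (e k))) j) \<longleftrightarrow>
          i ?s = q (e k) \<and> (\<forall>j\<in>{m<..m + n}. i j = \<beta> k j)"
        unfolding set by auto
      ultimately show ?thesis by simp
    qed
    finally show "contract_chain r V m (Suc n) k i l =
        of_bool ((\<forall>j\<in>{m<..?s}. i j = ((\<beta> k)(?s := q (e k))) j) \<and> l = h (e k))" .
  next
    fix k k' assume k: "k < r m" "k' < r m"
      and eq: "\<forall>j\<in>{m<..?s}. ((\<beta> k)(?s := q (e k))) j = ((\<beta> k')(?s := q (e k'))) j" "h (e k) = h (e k')"
    have "e k = e k'"
      using bspec[OF eq(1), of ?s] eq(2) k \<beta>(1) by (auto intro: qh(3))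
    moreover have "\<forall>j\<in>{m<..m + n}. \<beta> k j = \<beta> k' j"
    proof
      fix j assume "j \<in> {m<..m + n}"
      then show "\<beta> k j = \<beta> k' j" using bspec[OF eq(1), of j] by simp
    qed
    ultimately show "k = k'" using IH(3) k by simp
  qed
qed

text \<open>The structure behind both claims about the model classes: every matrix in \<^const>\<open>Q1\<close> merely relabels
  core positions as distinct multi-indices.\<close>
lemma Q1_unit_columns:
  assumes "(a, b, Q) \<in> Q1 M d m" "m \<in> {1..M}"
  obtains \<phi> where "inj_on \<phi> (core_idx a d b)" "\<phi> ` core_idx a d b \<subseteq> full_idx M d"
    "\<And>i c. i \<in> full_idx M d \<Longrightarrow> c \<in> core_idx a d b \<Longrightarrow> Q i c = of_bool (i = \<phi> c)"
proof -
  from assms(1) obtain r U V where r: "admissible_ranks M r" "a = r (m - 1)" "b = r m"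
    and U: "\<forall>j\<in>{1..<m}. binary_core (r (j - 1)) d (r j) (U j) \<and> left_orthogonal (r (j - 1)) d (r j) (U j)"
    and V: "\<forall>j\<in>{m<..M}. binary_core (r (j - 1)) d (r j) (V j) \<and> right_orthogonal (r (j - 1)) d (r j) (V j)"
    and Q: "Q = (\<lambda>i (k, j, l). contract_chain r U 0 (m - 1) 0 i k * (if i m = j then 1 else 0) *
                           contract_chain r V m (M - m) l i 0)"
    unfolding Q1_def by blast
  have r01: "r 0 = 1" "r M = 1" using r by (auto simp: admissible_ranks_def)
  have m: "{1..<m} = {1..m - 1}" "m + (M - m) = M" using assms(2) by auto
  obtain \<alpha> where \<alpha>: "\<And>l j. l < a \<Longrightarrow> j \<in> {1..<m} \<Longrightarrow> \<alpha> l j < d"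
    "\<And>l i. l < a \<Longrightarrow> \<forall>j\<in>{1..<m}. i j < d \<Longrightarrow>
        contract_chain r U 0 (m - 1) 0 i l = of_bool (\<forall>j\<in>{1..<m}. i j = \<alpha> l j)"
    "\<And>l l'. l < a \<Longrightarrow> l' < a \<Longrightarrow> \<forall>j\<in>{1..<m}. \<alpha> l j = \<alpha> l' j \<Longrightarrow> l = l'"
    using left_chain_unit_columns[of r "m - 1" d U] U r01 unfolding m r by blast
  obtain \<beta> e where B: "\<forall>k<b. e k < r M \<and> (\<forall>j\<in>{m<..M}. \<beta> k j < d)"
    "\<forall>k<b. \<forall>l<r M. \<forall>i. (\<forall>j\<in>{m<..M}. i j < d) \<longrightarrow>
        contract_chain r V m (M - m) k i l = of_bool ((\<forall>j\<in>{m<..M}. i j = \<beta> k j) \<and> l = e k)"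
    "\<forall>k<b. \<forall>k'<b. (\<forall>j\<in>{m<..M}. \<beta> k j = \<beta> k' j) \<longrightarrow> e k = e k' \<longrightarrow> k = k'"
    using right_chain_unit_rows[of m "M - m" r d V, unfolded m(2), OF V, folded r(3)]
    by (elim exE conjE) (rule that; assumption)
  have \<beta>: "\<And>k. k < b \<Longrightarrow> e k < r M"
    "\<And>k j. k < b \<Longrightarrow> j \<in> {m<..M} \<Longrightarrow> \<beta> k j < d"
    "\<And>k l i. k < b \<Longrightarrow> l < r M \<Longrightarrow> \<forall>j\<in>{m<..M}. i j < d \<Longrightarrow>
        contract_chain r V m (M - m) k i l = of_bool ((\<forall>j\<in>{m<..M}. i j = \<beta> k j) \<and> l = e k)"
    "\<And>k k'. k < b \<Longrightarrow> k' < b \<Longrightarrow> \<forall>j\<in>{m<..M}. \<beta> k j = \<beta> k' j \<Longrightarrow> e k = e k' \<Longrightarrow> k = k'"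
    using B by simp_all
  have e0: "e k = 0" if "k < b" for k using \<beta>(1)[OF that] r01 by simp
  define \<phi> :: "nat \<times> nat \<times> nat \<Rightarrow> mindex" where
    "\<phi> = (\<lambda>(k, j, l). \<lambda>t\<in>{1..M}. if t < m then \<alpha> k t else if t = m then j else \<beta> l t)"
  show ?thesis
  proof (rule that[of \<phi>])
    show "\<phi> ` core_idx a d b \<subseteq> full_idx M d"
    proof safe
      fix k j l assume "(k, j, l) \<in> core_idx a d b"
      then show "\<phi> (k, j, l) \<in> full_idx M d"
        using \<alpha>(1) \<beta>(2) unfolding \<phi>_def full_idx_def by (auto simp: core_idx_def)
    qed
    show "inj_on \<phi> (core_idx a d b)"
    proof (rule inj_onI)
      fix c c'
      assume cc: "c \<in> core_idx a d b" "c' \<in> core_idx a d b" "\<phi> c = \<phi> c'"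
      obtain k j l k' j' l' where [simp]: "c = (k, j, l)" "c' = (k', j', l')"
        by (cases c, cases c')
      have c: "(k, j, l) \<in> core_idx a d b" "(k', j', l') \<in> core_idx a d b"
        and eq: "\<phi> (k, j, l) = \<phi> (k', j', l')"
        using cc by simp_all
      have *: "(if t < m then \<alpha> k t else if t = m then j else \<beta> l t) = (if t < m then \<alpha> k' t else if t = m then j' else \<beta> l' t)"
        if "t \<in> {1..M}" for t
        using fun_cong[OF eq, of t] that by (simp add: \<phi>_def)
      have "j = j'" using *[of m] assms(2) by simp
      moreover have "k = k'"
      proof (rule \<alpha>(3))
        show "\<forall>t\<in>{1..<m}. \<alpha> k t = \<alpha> k' t"
        proof
          fix t assume "t \<in> {1..<m}" then show "\<alpha> k t = \<alpha> k' t" using *[of t] assms(2) by auto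
        qed
      qed (use c in \<open>auto simp: core_idx_def\<close>)
      moreover have "l = l'"
      proof (rule \<beta>(4))
        show "\<forall>t\<in>{m<..M}. \<beta> l t = \<beta> l' t"
        proof
          fix t assume "t \<in> {m<..M}" then show "\<beta> l t = \<beta> l' t" using *[of t] by auto
        qed
      qed (use c e0 in \<open>auto simp: core_idx_def\<close>)
      ultimately show "c = c'" by simp
    qed
    fix i c assume i: "i \<in> full_idx M d" and c: "c \<in> core_idx a d b"
    obtain k j l where [simp]: "c = (k, j, l)" by (cases c)
    have kl: "k < a" "l < b" using c by (auto simp: core_idx_def)
    have id: "i t < d" if "t \<in> {1..M}" for t using i that by (auto simp: full_idx_def)
    have "i = \<phi> c \<longleftrightarrow> (\<forall>t\<in>{1..M}. i t = \<phi> c t)"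
      using i by (auto simp: full_idx_def \<phi>_def PiE_iff extensional_def fun_eq_iff)
    also have "\<dots> \<longleftrightarrow> (\<forall>t\<in>{1..<m}. i t = \<alpha> k t) \<and> i m = j \<and> (\<forall>t\<in>{m<..M}. i t = \<beta> l t)"
      using assms(2) by (fastforce simp: \<phi>_def nat_neq_iff)
    finally have iff: "i = \<phi> c \<longleftrightarrow> (\<forall>t\<in>{1..<m}. i t = \<alpha> k t) \<and> i m = j \<and> (\<forall>t\<in>{m<..M}. i t = \<beta> l t)" .
    have "contract_chain r U 0 (m - 1) 0 i k = of_bool (\<forall>t\<in>{1..<m}. i t = \<alpha> k t)"
      using kl id assms(2) by (intro \<alpha>(2)) auto
    moreover have "contract_chain r V m (M - m) l i 0 = of_bool (\<forall>t\<in>{m<..M}. i t = \<beta> l t)"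
      using kl id assms(2) r01 e0 by (subst \<beta>(3)) auto
    ultimately show "Q i c = of_bool (i = \<phi> c)"
      unfolding iff by (auto simp: Q)
  qed
qed

lemma finite_full_idx [simp]: "finite (full_idx M d)"
  unfolding full_idx_def by (intro finite_PiE) auto

lemma finite_core_idx [simp]: "finite (core_idx a d b)"
  unfolding core_idx_def by auto

lemma gram_unit_columns:
  assumes "inj_on \<phi> (core_idx a d b)" "\<phi> ` core_idx a d b \<subseteq> full_idx M d"
    and Q: "\<And>i c. i \<in> full_idx M d \<Longrightarrow> c \<in> core_idx a d b \<Longrightarrow> Q i c = of_bool (i = \<phi> c)"
    and c: "c \<in> core_idx a d b" "c' \<in> core_idx a d b"
  shows "gram M d w Q c c' = (if c = c' then w (\<phi> c) else 0)"
proof -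
  have "gram M d w Q c c' = (\<Sum>i\<in>full_idx M d. if i = \<phi> c then w i * of_bool (i = \<phi> c') else 0)"
    unfolding gram_def using Q c by (intro sum.cong) auto
  also have "\<dots> = w (\<phi> c) * of_bool (\<phi> c = \<phi> c')"
    using assms(2) c by auto
  also have "\<dots> = (if c = c' then w (\<phi> c) else 0)"
    using assms(1) c by (auto simp: inj_on_eq_iff)
  finally show ?thesis .
qed

lemma transpose_apply_unit_columns:
  assumes "\<phi> ` core_idx a d b \<subseteq> full_idx M d"
    and Q: "\<And>i c. i \<in> full_idx M d \<Longrightarrow> c \<in> core_idx a d b \<Longrightarrow> Q i c = of_bool (i = \<phi> c)"
    and c: "c \<in> core_idx a d b"
  shows "transpose_apply M d Q x c = x (\<phi> c)"
proof -
  have "transpose_apply M d Q x c = (\<Sum>i\<in>full_idx M d. if i = \<phi> c then x i else 0)"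
    unfolding transpose_apply_def using Q c by (intro sum.cong) auto
  then show ?thesis using assms(1) c by auto
qed

text \<open>With distinct unit vectors as columns, \<open>Q\<^sup>T diag(w) Q\<close> is diagonal with entries \<open>w (\<phi> c)\<close> for every
  \<open>w\<close>; for \<open>w = \<omega>\<^sup>2\<close> its diagonal consists of the squares of \<open>Q\<^sup>T \<omega>\<close>, so the two sparsity measures
  agree as well.\<close>
lemma Q1_subset_Q2:
  assumes "(a, b, Q) \<in> Q1 M d m" "m \<in> {1..M}"
  shows "(a, b, Q) \<in> Q2 M d \<omega> m"
    and "weighted_l0 (core_idx a d b) (omega_Q M d \<omega> Q) C =
         weighted_l0 (core_idx a d b) (transpose_apply M d Q \<omega>) C"
proof -
  obtain \<phi> where \<phi>: "inj_on \<phi> (core_idx a d b)" "\<phi> ` core_idx a d b \<subseteq> full_idx M d"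
    "\<And>i c. i \<in> full_idx M d \<Longrightarrow> c \<in> core_idx a d b \<Longrightarrow> Q i c = of_bool (i = \<phi> c)"
    using Q1_unit_columns[OF assms] by blast
  note gr = gram_unit_columns[where Q=Q, OF \<phi>]
  from assms(1) obtain r where r: "admissible_ranks M r" "a = r (m - 1)" "b = r m"
    unfolding Q1_def by blast
  have "\<forall>c\<in>core_idx a d b. \<forall>c'\<in>core_idx a d b.
        gram M d (\<lambda>_. 1) Q c c' = (if c = c' then 1 else 0) \<and>
        (c \<noteq> c' \<longrightarrow> gram M d (\<lambda>i. (\<omega> i)\<^sup>2) Q c c' = 0)"
    by (simp add: gr)
  then show "(a, b, Q) \<in> Q2 M d \<omega> m"
    using r unfolding Q2_def by blast
  show "weighted_l0 (core_idx a d b) (omega_Q M d \<omega> Q) C =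
         weighted_l0 (core_idx a d b) (transpose_apply M d Q \<omega>) C"
    unfolding weighted_l0_def
    by (intro sum.cong) (auto simp: omega_Q_def gr transpose_apply_unit_columns[where Q=Q, OF \<phi>(2,3)])
qed

lemma model1_subset_model2: "model1 M d R \<omega> \<subseteq> model2 M d R \<omega>"
proof
  fix x assume x: "x \<in> model1 M d R \<omega>"
  show "x \<in> model2 M d R \<omega>"
    unfolding model2_def
  proof
    fix m assume m: "m \<in> {1..M}"
    then obtain a b Q C where Q: "(a, b, Q) \<in> Q1 M d m" "x = apply_matrix M d a b Q C"
      "weighted_l0 (core_idx a d b) (transpose_apply M d Q \<omega>) C \<le> R"
      using x unfolding model1_def by fastforce
    then show "x \<in> (\<Union>(a, b, Q)\<in>Q2 M d \<omega> m.
        {apply_matrix M d a b Q C | C. weighted_l0 (core_idx a d b) (omega_Q M d \<omega> Q) C \<le> R})"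
      using Q1_subset_Q2[OF Q(1) m, of \<omega>] by fastforce
  qed
qed


lemma digit_iff: "l = k * d + j \<longleftrightarrow> k = l div d \<and> j = l mod d" if "j < d" for j d k l :: nat
  using that by auto

lemma sum_digit:
  fixes f :: "nat \<Rightarrow> nat \<Rightarrow> real"
  assumes "l < a * d"
  shows "(\<Sum>k<a. \<Sum>j<d. of_bool (l = k * d + j) * f k j) = f (l div d) (l mod d)"
proof -
  have d: "0 < d" using assms by (cases d) auto
  have "(\<Sum>k<a. \<Sum>j<d. of_bool (l = k * d + j) * f k j) =
      (\<Sum>k<a. if k = l div d then (\<Sum>j<d. if j = l mod d then f k j else 0) else 0)"
    by (intro sum.cong refl) (auto simp: digit_iff intro!: sum.cong sum.neutral)
  also have "\<dots> = f (l div d) (l mod d)"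
    using assms d by (simp add: less_mult_imp_div_less)
  finally show ?thesis .
qed

text \<open>To show that sparse tensors belong to the first model class, it suffices to use maximal ranks,
  which may be arbitrarily large there. The cores then append one base-\<open>d\<close> digit to an integer, or
  strip one off.\<close>
definition digit_core :: "nat \<Rightarrow> tensor3" where
  "digit_core d = (\<lambda>(k, j, l). of_bool (l = k * d + j))"

definition digit_core_rev :: "nat \<Rightarrow> tensor3" where
  "digit_core_rev d = (\<lambda>(k, j, l). of_bool (k = l * d + j))"

lemma digit_core_properties:
  shows "binary_core a d (a * d) (digit_core d)"
    and "left_orthogonal a d (a * d) (digit_core d)"
    and "sparse_core (a * d) a d (a * d) (digit_core d)"
proof -
  show "binary_core a d (a * d) (digit_core d)"
    by (auto simp: binary_core_def digit_core_def)
  show "left_orthogonal a d (a * d) (digit_core d)"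
    unfolding left_orthogonal_def
  proof (intro allI impI)
    fix l l' assume l: "l < a * d" "l' < a * d"
    show "(\<Sum>k<a. \<Sum>j<d. digit_core d (k, j, l) * digit_core d (k, j, l')) = (if l = l' then 1 else 0)"
      using sum_digit[OF l(1), of "\<lambda>k j. of_bool (l' = k * d + j)"] by (simp only: digit_core_def prod.case) auto
  qed
  have "{c \<in> core_idx a d (a * d). digit_core d c \<noteq> 0} \<subseteq> (\<lambda>l. (l div d, l mod d, l)) ` {..<a * d}"
    by (auto simp: core_idx_def digit_core_def image_iff)
  then have "card {c \<in> core_idx a d (a * d). digit_core d c \<noteq> 0} \<le> card {..<a * d}"
    by (rule surj_card_le[rotated]) simp
  then show "sparse_core (a * d) a d (a * d) (digit_core d)"
    by (simp add: sparse_core_def)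
qed

lemma digit_core_rev_properties:
  shows "binary_core (b * d) d b (digit_core_rev d)"
    and "right_orthogonal (b * d) d b (digit_core_rev d)"
    and "sparse_core (b * d) (b * d) d b (digit_core_rev d)"
proof -
  show "binary_core (b * d) d b (digit_core_rev d)"
    by (auto simp: binary_core_def digit_core_rev_def)
  show "right_orthogonal (b * d) d b (digit_core_rev d)"
    unfolding right_orthogonal_def
  proof (intro allI impI)
    fix k k' assume k: "k < b * d" "k' < b * d"
    show "(\<Sum>j<d. \<Sum>l<b. digit_core_rev d (k, j, l) * digit_core_rev d (k', j, l)) = (if k = k' then 1 else 0)"
      using sum_digit[OF k(1), of "\<lambda>l j. of_bool (k' = l * d + j)"]
      by (subst sum.swap) (simp only: digit_core_rev_def prod.case, auto)
  qed
  have "{c \<in> core_idx (b * d) d b. digit_core_rev d c \<noteq> 0} \<subseteq> (\<lambda>k. (k, k mod d, k div d)) ` {..<b * d}"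
    by (auto simp: core_idx_def digit_core_rev_def image_iff)
  then have "card {c \<in> core_idx (b * d) d b. digit_core_rev d c \<noteq> 0} \<le> card {..<b * d}"
    by (rule surj_card_le[rotated]) simp
  then show "sparse_core (b * d) (b * d) d b (digit_core_rev d)"
    by (simp add: sparse_core_def)
qed

lemma Q1_full_rank:
  assumes "0 < d" "m \<in> {1..M}"
  obtains Q where "(d ^ (m - 1), d ^ (M - m), Q) \<in> Q1 M d m"
proof -
  define r where "r = (\<lambda>j. if j < m then d ^ j else d ^ (M - j))"
  have adm: "admissible_ranks M r"
    using assms by (auto simp: admissible_ranks_def r_def)
  have U: "r j = r (j - 1) * d" if "j \<in> {1..<m}" for j
    using that by (cases j) (auto simp: r_def)
  have V: "r (j - 1) = r j * d" if "j \<in> {m<..M}" for j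
    using that assms by (cases j) (auto simp: r_def Suc_diff_Suc power_Suc2[symmetric] simp del: power_Suc)
  define Q :: core_matrix where
    "Q = (\<lambda>i (k, j, l). contract_chain r (\<lambda>_. digit_core d) 0 (m - 1) 0 i k * (if i m = j then 1 else 0) *
                           contract_chain r (\<lambda>_. digit_core_rev d) m (M - m) l i 0)"
  have U': "binary_core (r (j - 1)) d (r j) (digit_core d) \<and>
      left_orthogonal (r (j - 1)) d (r j) (digit_core d) \<and>
      sparse_core (r j) (r (j - 1)) d (r j) (digit_core d)" if "j \<in> {1..<m}" for j
    using digit_core_properties[of "r (j - 1)" d] U[OF that] by simp
  have V': "binary_core (r (j - 1)) d (r j) (digit_core_rev d) \<and>
      right_orthogonal (r (j - 1)) d (r j) (digit_core_rev d) \<and>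
      sparse_core (r (j - 1)) (r (j - 1)) d (r j) (digit_core_rev d)" if "j \<in> {m<..M}" for j
    using digit_core_rev_properties[of "r j" d] V[OF that] by simp
  have "\<exists>U V. (\<forall>j\<in>{1..<m}. binary_core (r (j - 1)) d (r j) (U j) \<and>
                     left_orthogonal (r (j - 1)) d (r j) (U j) \<and>
                     sparse_core (r j) (r (j - 1)) d (r j) (U j)) \<and>
        (\<forall>j\<in>{m<..M}. binary_core (r (j - 1)) d (r j) (V j) \<and>
                     right_orthogonal (r (j - 1)) d (r j) (V j) \<and>
                     sparse_core (r (j - 1)) (r (j - 1)) d (r j) (V j)) \<and>
        Q = (\<lambda>i (k, j, l). contract_chain r U 0 (m - 1) 0 i k * (if i m = j then 1 else 0) *
                           contract_chain r V m (M - m) l i 0)"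
    by (rule exI[of _ "\<lambda>_. digit_core d"], rule exI[of _ "\<lambda>_. digit_core_rev d"])
       (use U' V' in \<open>simp add: Q_def\<close>)
  then have "(r (m - 1), r m, Q) \<in> Q1 M d m"
    using adm unfolding Q1_def by fast
  moreover have "r (m - 1) = d ^ (m - 1)" "r m = d ^ (M - m)"
    using assms by (auto simp: r_def)
  ultimately show ?thesis using that by metis
qed

text \<open>At maximal ranks the relabelling \<open>\<phi>\<close> of \<open>Q1_unit_columns\<close> is an injection between sets of equal
  cardinality \<open>d ^ M\<close>, hence a bijection, and every tensor is the image of its own relabelling.\<close>
lemma sparse_tensor_in_model1:
  assumes d: "0 < d" and x: "x \<in> extensional (multi_index M)"
    and \<Lambda>: "finite \<Lambda>" "\<Lambda> \<subseteq> full_idx M d" "\<And>i. i \<in> multi_index M \<Longrightarrow> i \<notin> \<Lambda> \<Longrightarrow> x i = 0"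
    and R: "(\<Sum>i\<in>\<Lambda>. (\<omega> i)\<^sup>2) \<le> R"
  shows "x \<in> model1 M d R \<omega>"
  unfolding model1_def
proof
  fix m assume m: "m \<in> {1..M}"
  define a where "a = d ^ (m - 1)"
  define b where "b = d ^ (M - m)"
  obtain Q where Q: "(a, b, Q) \<in> Q1 M d m"
    using Q1_full_rank[OF d m] unfolding a_def b_def by blast
  obtain \<phi> where \<phi>: "inj_on \<phi> (core_idx a d b)" "\<phi> ` core_idx a d b \<subseteq> full_idx M d"
    "\<And>i c. i \<in> full_idx M d \<Longrightarrow> c \<in> core_idx a d b \<Longrightarrow> Q i c = of_bool (i = \<phi> c)"
    using Q1_unit_columns[OF Q m] by blast
  have sub: "full_idx M d \<subseteq> multi_index M"
    unfolding full_idx_def multi_index_def by (intro PiE_mono) auto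
  have "card (core_idx a d b) = a * d * b"
    by (simp add: core_idx_def card_cartesian_product mult.assoc)
  also have "\<dots> = d ^ ((m - 1) + 1 + (M - m))"
    by (simp only: a_def b_def power_add power_one_right)
  also have "(m - 1) + 1 + (M - m) = M" using m by auto
  also have "d ^ M = card (full_idx M d)"
    by (simp add: full_idx_def card_PiE)
  finally have surj: "\<phi> ` core_idx a d b = full_idx M d"
    using \<phi> by (intro card_subset_eq) (simp_all add: card_image)
  define C where "C = (\<lambda>c. x (\<phi> c))"
  have "x = apply_matrix M d a b Q C"
  proof (rule extensionalityI[OF x])
    show "apply_matrix M d a b Q C \<in> extensional (multi_index M)"
      by (simp add: apply_matrix_def)
    fix i assume i: "i \<in> multi_index M"
    show "x i = apply_matrix M d a b Q C i"
    proof (cases "i \<in> full_idx M d")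
      case True
      then obtain c0 where c0: "c0 \<in> core_idx a d b" "i = \<phi> c0" using surj by blast
      have "(\<Sum>c\<in>core_idx a d b. Q i c * C c) = (\<Sum>c\<in>core_idx a d b. if c = c0 then C c0 else 0)"
        using \<phi>(1,3) True c0 by (intro sum.cong) (auto simp: inj_on_eq_iff)
      then show ?thesis using i True c0 by (simp add: apply_matrix_def C_def)
    next
      case False
      then show ?thesis using i \<Lambda> by (auto simp: apply_matrix_def)
    qed
  qed
  moreover have "weighted_l0 (core_idx a d b) (transpose_apply M d Q \<omega>) C \<le> R"
  proof -
    have "weighted_l0 (core_idx a d b) (transpose_apply M d Q \<omega>) C =
        (\<Sum>c\<in>{c\<in>core_idx a d b. C c \<noteq> 0}. (\<omega> (\<phi> c))\<^sup>2)"
      unfolding weighted_l0_def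
      by (intro sum.cong) (auto simp: transpose_apply_unit_columns[where Q=Q, OF \<phi>(2,3)])
    also have "\<dots> = (\<Sum>i\<in>\<phi> ` {c\<in>core_idx a d b. C c \<noteq> 0}. (\<omega> i)\<^sup>2)"
      by (subst sum.reindex) (auto intro: inj_on_subset[OF \<phi>(1)])
    also have "\<dots> \<le> (\<Sum>i\<in>\<Lambda>. (\<omega> i)\<^sup>2)"
    proof (rule sum_mono2[OF \<Lambda>(1)])
      show "\<phi> ` {c\<in>core_idx a d b. C c \<noteq> 0} \<subseteq> \<Lambda>"
        using \<Lambda>(3) \<phi>(2) sub by (force simp: C_def)
    qed auto
    finally show ?thesis using R by simp
  qed
  ultimately show "x \<in> (\<Union>(a, b, Q)\<in>Q1 M d m.
      {apply_matrix M d a b Q C | C. weighted_l0 (core_idx a d b) (transpose_apply M d Q \<omega>) C \<le> R})"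
    using Q by blast
qed

section \<open>Univariate Legendre polynomials\<close>

definition interval_measure :: "real measure" where
  "interval_measure = uniform_measure lborel {-1..1}"

lemma prob_space_interval_measure: "prob_space interval_measure"
  unfolding interval_measure_def by (rule prob_space_uniform_measure) auto

lemma sets_interval_measure [measurable_cong, simp]: "sets interval_measure = sets borel"
  by (simp add: interval_measure_def)

lemma space_interval_measure [simp]: "space interval_measure = UNIV"
  by (simp add: interval_measure_def)

lemma AE_interval_measure: "AE x in interval_measure. x \<in> {-1..1}"
  unfolding interval_measure_def by (rule AE_uniform_measureI) auto

lemma integrable_interval_measure_poly: "integrable interval_measure (poly p)" for p :: "real poly"
proof -
  interpret prob_space interval_measure by (rule prob_space_interval_measure)
  have "bounded (poly p ` {-1..1})"
    by (intro compact_imp_bounded compact_continuous_image continuous_on_poly continuous_on_id) auto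
  then obtain B where B: "\<And>x. x \<in> {-1..1} \<Longrightarrow> norm (poly p x) \<le> B"
    unfolding bounded_iff by blast
  show ?thesis
  proof (rule integrable_const_bound)
    show "AE x in interval_measure. norm (poly p x) \<le> B"
      using AE_interval_measure by eventually_elim (rule B)
    show "poly p \<in> borel_measurable interval_measure"
      unfolding measurable_cong_sets[OF sets_interval_measure refl]
      by (intro borel_measurable_continuous_onI continuous_intros)
  qed
qed

definition poly_mean :: "real poly \<Rightarrow> real" where
  "poly_mean p = (LINT x|interval_measure. poly p x)"

lemma poly_mean_add: "poly_mean (p + q) = poly_mean p + poly_mean q"
  by (simp add: poly_mean_def integrable_interval_measure_poly )

lemma poly_mean_smult: "poly_mean (smult c p) = c * poly_mean p"
  by (simp add: poly_mean_def)

lemma poly_mean_0 [simp]: "poly_mean 0 = 0"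
  by (simp add: poly_mean_def)

lemma poly_mean_1 [simp]: "poly_mean 1 = 1"
proof -
  interpret prob_space interval_measure by (rule prob_space_interval_measure)
  show ?thesis using prob_space by (simp add: poly_mean_def)
qed

text \<open>The fundamental theorem of calculus; together with linearity and the normalization it is all that the
  orthogonality relations need to know about the integral.\<close>
lemma poly_mean_pderiv: "poly_mean (pderiv p) = (poly p 1 - poly p (-1)) / 2"
proof -
  have m: "(\<lambda>x. poly (pderiv p) x) \<in> borel_measurable lborel"
    by (simp add: borel_measurable_continuous_onI continuous_intros)
  have "poly_mean (pderiv p) = (LINT x|density lborel (\<lambda>x. ennreal (indicator {-1..1} x / 2)). poly (pderiv p) x)"
    unfolding poly_mean_def interval_measure_def uniform_measure_def
    by (intro arg_cong[where f="\<lambda>M. integral\<^sup>L M _"] density_cong)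
       (auto simp: indicator_def divide_ennreal_def inverse_ennreal ennreal_divide_numeral split: if_splits)
  also have "\<dots> = (LINT x|lborel. indicator {-1..1} x / 2 * poly (pderiv p) x)"
    using m by (subst integral_density) auto
  also have "\<dots> = (LINT x|lborel. indicator {-1..1} x *\<^sub>R poly (pderiv p) x) / 2"
    by (subst integral_divide_zero[symmetric]) simp
  also have "(LINT x|lborel. indicator {-1..1} x *\<^sub>R poly (pderiv p) x) = poly p 1 - poly p (-1)"
    by (intro integral_FTC_atLeastAtMost)
       (auto intro!: continuous_intros has_field_derivative_at_within poly_DERIV
             simp: has_real_derivative_iff_has_vector_derivative[symmetric])
  finally show ?thesis .
qed

lemma poly_mean_by_parts:
  "poly_mean (pderiv p * q) =
     (poly p 1 * poly q 1 - poly p (-1) * poly q (-1)) / 2 - poly_mean (p * pderiv q)"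
  using poly_mean_pderiv[of "p * q"]
  by (simp add: pderiv_mult poly_mean_add algebra_simps)

lemma root_power_dvd_higher_pderiv:
  fixes p :: "real poly"
  assumes "[:-a, 1:] ^ n dvd p"
  shows "[:-a, 1:] ^ (n - k) dvd (pderiv ^^ k) p"
proof (induction k)
  case 0
  then show ?case using assms by simp
next
  case (Suc k)
  show ?case
  proof (cases "n - k")
    case 0
    then show ?thesis by simp
  next
    case (Suc m)
    then obtain q where q: "(pderiv ^^ k) p = [:-a, 1:] ^ Suc m * q"
      using Suc.IH by (metis dvdE)
    have "pderiv ([:-a, 1:] ^ Suc m * q) = [:-a, 1:] ^ m * (smult (of_nat (Suc m)) q + [:-a, 1:] * pderiv q)"
      by (simp only: pderiv_mult pderiv_power_Suc) (simp add: pderiv_pCons algebra_simps)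
    moreover have "n - Suc k = m" using Suc by simp
    ultimately show ?thesis using q by (simp del: power_Suc)
  qed
qed

lemma poly_higher_pderiv_root_power:
  fixes q :: "real poly"
  shows "poly ((pderiv ^^ n) ([:-a, 1:] ^ n * q)) a = fact n * poly q a"
proof (induction n arbitrary: q)
  case 0
  then show ?case by simp
next
  case (Suc n)
  have "pderiv ([:-a, 1:] ^ Suc n * q) = [:-a, 1:] ^ n * (smult (of_nat (Suc n)) q + [:-a, 1:] * pderiv q)"
    by (simp only: pderiv_mult pderiv_power_Suc) (simp add: pderiv_pCons algebra_simps)
  then show ?case
    using Suc.IH[of "smult (of_nat (Suc n)) q + [:-a, 1:] * pderiv q"]
    by (simp del: funpow.simps power_Suc add: funpow_Suc_right fact_Suc)
qed

abbreviation rodrigues_poly :: "nat \<Rightarrow> real poly" where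
  "rodrigues_poly n \<equiv> [:-1, 0, 1:] ^ n"

lemma rodrigues_poly_factor: "rodrigues_poly n = [:-1, 1:] ^ n * [:1, 1:] ^ n"
  by (simp add: power_mult_distrib[symmetric])

lemma degree_rodrigues_poly: "degree (rodrigues_poly n) = 2 * n"
  by (simp add: degree_power_eq)

lemma poly_higher_pderiv_rodrigues_eq_0:
  assumes "k < n" "x \<in> {1, -1}"
  shows "poly ((pderiv ^^ k) (rodrigues_poly n)) x = 0"
proof -
  have "[:-x, 1:] ^ n dvd rodrigues_poly n"
    using assms(2) by (auto simp: rodrigues_poly_factor)
  then have "[:-x, 1:] ^ (n - k) dvd (pderiv ^^ k) (rodrigues_poly n)"
    by (rule root_power_dvd_higher_pderiv)
  moreover have "[:-x, 1:] dvd [:-x, 1:] ^ (n - k)"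
    using assms(1) by (intro dvd_power) auto
  ultimately show ?thesis
    using dvd_trans poly_eq_0_iff_dvd by blast
qed

text \<open>Repeated integration by parts: the boundary terms vanish because the derivatives of
  \<open>(x\<^sup>2 - 1) ^ n\<close> of order below \<open>n\<close> vanish at \<open>1\<close> and \<open>-1\<close>.\<close>
lemma poly_mean_mult_rodrigues:
  "poly_mean (q * (pderiv ^^ n) (rodrigues_poly n)) = (-1) ^ n * poly_mean ((pderiv ^^ n) q * rodrigues_poly n)"
proof -
  have "poly_mean (q * (pderiv ^^ n) (rodrigues_poly n)) =
      (-1) ^ k * poly_mean ((pderiv ^^ k) q * (pderiv ^^ (n - k)) (rodrigues_poly n))" if "k \<le> n" for k
    using that
  proof (induction k)
    case (Suc k)
    let ?r = "(pderiv ^^ (n - Suc k)) (rodrigues_poly n)"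
    have "(pderiv ^^ (n - k)) (rodrigues_poly n) = pderiv ?r"
      using Suc.prems by (metis Suc_diff_Suc Suc_le_lessD comp_apply funpow.simps(2))
    moreover have "poly ?r 1 = 0" "poly ?r (-1) = 0"
      using Suc.prems by (auto intro!: poly_higher_pderiv_rodrigues_eq_0)
    ultimately have "poly_mean ((pderiv ^^ (n - k)) (rodrigues_poly n) * (pderiv ^^ k) q) =
        - poly_mean (?r * (pderiv ^^ Suc k) q)"
      by (simp add: poly_mean_by_parts)
    then show ?case using Suc by (simp add: mult.commute)
  qed simp
  from this[of n] show ?thesis by simp
qed

lemma higher_pderiv_degree_le:
  fixes q :: "real poly"
  assumes "degree q \<le> n"
  shows "(pderiv ^^ n) q = [:fact n * coeff q n:]"
proof (rule poly_eqI)
  fix m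
  show "coeff ((pderiv ^^ n) q) m = coeff [:fact n * coeff q n:] m"
  proof (cases m)
    case 0
    then show ?thesis by (simp add: coeff_higher_pderiv pochhammer_fact)
  next
    case (Suc k)
    then have "coeff q (m + n) = 0" using assms by (intro coeff_eq_0) auto
    then show ?thesis using Suc by (simp add: coeff_higher_pderiv)
  qed
qed

text \<open>Integration by parts against the factor \<open>x\<close> gives the recursion
  \<open>(2 n + 3) I (n + 1) = - 2 (n + 1) I n\<close> for the means \<open>I n\<close>.\<close>
lemma poly_mean_rodrigues:
  "poly_mean (rodrigues_poly n) = (-1) ^ n * 4 ^ n * (fact n)\<^sup>2 / fact (2 * n + 1)"
proof (induction n)
  case 0
  then show ?case by simp
next
  case (Suc n)
  have "pderiv (rodrigues_poly (Suc n)) = smult (2 * real (Suc n)) ([:0, 1:] * rodrigues_poly n)"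
    by (simp only: pderiv_power_Suc) (simp add: pderiv_pCons algebra_simps)
  then have "[:0, 1:] * pderiv (rodrigues_poly (Suc n)) =
      smult (2 * real (Suc n)) (rodrigues_poly (Suc n) + rodrigues_poly n)"
    by (simp add: algebra_simps)
  moreover have "pderiv [:0, 1:] * rodrigues_poly (Suc n) = rodrigues_poly (Suc n)"
    by (simp add: pderiv_pCons)
  ultimately have "poly_mean (rodrigues_poly (Suc n)) =
      - (2 * real (Suc n) * (poly_mean (rodrigues_poly (Suc n)) + poly_mean (rodrigues_poly n)))"
    using poly_mean_by_parts[of "[:0, 1:]" "rodrigues_poly (Suc n)"]
    by (simp del: power_Suc add: poly_mean_smult poly_mean_add)
  then have "(2 * real n + 3) * poly_mean (rodrigues_poly (Suc n)) = - (2 * real (Suc n)) * poly_mean (rodrigues_poly n)"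
    by (simp add: algebra_simps)
  then have "poly_mean (rodrigues_poly (Suc n)) = - (2 * real (Suc n)) / (2 * real n + 3) * poly_mean (rodrigues_poly n)"
    by (simp add: field_simps)
  also have "\<dots> = (-1) ^ Suc n * 4 ^ Suc n * (fact (Suc n))\<^sup>2 / fact (2 * Suc n + 1)"
  proof -
    have "fact (2 * Suc n + 1) = (2 * real n + 3) * (2 * real (Suc n)) * fact (2 * n + 1)"
      by (simp add: algebra_simps)
    then show ?thesis unfolding Suc.IH
      by (simp add: divide_simps power2_eq_square del: fact_Suc of_nat_Suc) (simp add: algebra_simps)
  qed
  finally show ?case .
qed

lemma degree_legendre_poly: "degree (legendre_poly n) = n"
  unfolding legendre_poly_def by (simp add: degree_higher_pderiv degree_rodrigues_poly)

text \<open>This value is the source of the lower bound for the sup norm of the Legendre polynomials.\<close>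
lemma poly_legendre_poly_1: "poly (legendre_poly n) 1 = sqrt (2 * real n + 1)"
  using poly_higher_pderiv_root_power[of n 1 "[:1, 1:] ^ n"]
  by (simp add: legendre_poly_def rodrigues_poly_factor)

lemma poly_mean_legendre_less:
  assumes "m < n"
  shows "poly_mean (legendre_poly m * legendre_poly n) = 0"
proof -
  have "(pderiv ^^ n) (legendre_poly m) = 0"
    using assms by (simp add: higher_pderiv_degree_le degree_legendre_poly coeff_eq_0)
  then have "poly_mean (legendre_poly m * (pderiv ^^ n) (rodrigues_poly n)) = 0"
    by (simp add: poly_mean_mult_rodrigues)
  then show ?thesis
    by (simp add: legendre_poly_def[of n] poly_mean_smult)
qed

text \<open>Integration by parts moves all derivatives onto the other factor, where the derivative of order
  \<open>2 n\<close> of the monic polynomial \<open>(x\<^sup>2 - 1) ^ n\<close> is the constant \<open>(2 n)!\<close>.\<close>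
lemma poly_mean_legendre_square: "poly_mean (legendre_poly n * legendre_poly n) = 1"
proof -
  define R where "R = (pderiv ^^ n) (rodrigues_poly n)"
  define c where "c = sqrt (2 * real n + 1) / (2 ^ n * fact n)"
  have L: "legendre_poly n = smult c R" by (simp add: legendre_poly_def R_def c_def)
  have lc: "coeff (rodrigues_poly n) (2 * n) = 1"
    using lead_coeff_power[of "[:-1, 0, 1:] :: real poly" n] by (simp add: degree_rodrigues_poly)
  have "(pderiv ^^ n) R = (pderiv ^^ (2 * n)) (rodrigues_poly n)"
    by (simp add: R_def funpow_add mult_2)
  also have "\<dots> = [:fact (2 * n):]"
    by (subst higher_pderiv_degree_le) (simp_all add: degree_rodrigues_poly lc)
  finally have D: "(pderiv ^^ n) R = [:fact (2 * n):]" .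
  have "poly_mean (R * R) = (-1) ^ n * poly_mean ([:fact (2 * n):] * rodrigues_poly n)"
    using poly_mean_mult_rodrigues[of R n] D by (simp add: R_def)
  also have "\<dots> = 4 ^ n * (fact n)\<^sup>2 / (2 * real n + 1)"
  proof -
    have "fact (2 * n + 1) = (2 * real n + 1) * fact (2 * n)" by simp
    moreover have "(-1) ^ n * ((-1) ^ n * x) = x" for x :: real
      by (simp add: mult.assoc[symmetric] power_mult_distrib[symmetric])
    ultimately show ?thesis
      by (simp add: poly_mean_smult poly_mean_rodrigues mult.assoc del: fact_Suc)
  qed
  finally have RR: "poly_mean (R * R) = 4 ^ n * (fact n)\<^sup>2 / (2 * real n + 1)" .
  have "c\<^sup>2 = (2 * real n + 1) / (4 ^ n * (fact n)\<^sup>2)"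
    using power_mult[of "2 :: real" 2 n]
    by (simp add: c_def power_divide power_mult_distrib power_mult[symmetric] mult.commute)
  then show ?thesis
    using RR by (simp add: L poly_mean_smult power2_eq_square mult.assoc[symmetric])
qed

lemma poly_mean_legendre:
  "poly_mean (legendre_poly m * legendre_poly n) = (if m = n then 1 else 0)"
  using poly_mean_legendre_less[of m n] poly_mean_legendre_less[of n m] poly_mean_legendre_square[of n]
  by (cases m n rule: linorder_cases) (auto simp: mult.commute)

lemma legendre_poly_span:
  fixes p :: "real poly"
  assumes "degree p \<le> n"
  shows "\<exists>a. p = (\<Sum>j\<le>n. smult (a j) (legendre_poly j))"
  using assms
proof (induction n arbitrary: p)
  case 0
  have "coeff (legendre_poly 0) 0 \<noteq> 0"
    using degree_legendre_poly[of 0] by (metis degree_0 leading_coeff_0_iff poly_0 poly_legendre_poly_1 of_nat_0 mult_zero_right add_0 real_sqrt_one zero_neq_one)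
  then have "p = smult (coeff p 0 / coeff (legendre_poly 0) 0) (legendre_poly 0)"
    using 0 by (intro poly_eqI) (metis coeff_smult degree_legendre_poly gr0I le_degree le_zero_eq mult_zero_right nonzero_eq_divide_eq)
  then show ?case by (intro exI[of _ "\<lambda>_. coeff p 0 / coeff (legendre_poly 0) 0"]) simp
next
  case (Suc n)
  define c where "c = coeff p (Suc n) / coeff (legendre_poly (Suc n)) (Suc n)"
  define q where "q = p - smult c (legendre_poly (Suc n))"
  have "legendre_poly (Suc n) \<noteq> 0"
    using degree_legendre_poly[of "Suc n"] by auto
  then have "coeff (legendre_poly (Suc n)) (Suc n) \<noteq> 0"
    using degree_legendre_poly[of "Suc n"] by (metis leading_coeff_0_iff)
  then have "coeff q (Suc n) = 0" by (simp add: q_def c_def)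
  moreover have "degree q \<le> Suc n"
    unfolding q_def using Suc.prems degree_legendre_poly[of "Suc n"]
    by (intro degree_diff_le order.trans[OF degree_smult_le]) auto
  ultimately have "degree q \<le> n"
    by (metis degree_0 le_Suc_eq leading_coeff_0_iff le0)
  from Suc.IH[OF this] obtain a where "q = (\<Sum>j\<le>n. smult (a j) (legendre_poly j))" by auto
  then have "p = (\<Sum>j\<le>Suc n. smult ((a(Suc n := c)) j) (legendre_poly j))"
    by (simp add: q_def algebra_simps)
  then show ?case by blast
qed

section \<open>The uniform measure on the cube and sup norms\<close>

lemma product_sigma_finite_interval: "product_sigma_finite (\<lambda>_ :: nat. interval_measure)"
proof -
  interpret prob_space interval_measure by (rule prob_space_interval_measure)
  show ?thesis by (intro product_sigma_finite.intro) unfold_locales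
qed

lemma emeasure_interval_measure:
  assumes "A \<in> sets borel"
  shows "emeasure interval_measure A = emeasure lborel ({-1..1} \<inter> A) / 2"
  unfolding interval_measure_def using assms by (subst emeasure_uniform_measure) auto

lemma cube_measure_eq_PiM: "cube_measure M = Pi\<^sub>M {1..M} (\<lambda>_. interval_measure)"
proof -
  interpret I: product_sigma_finite "\<lambda>_ :: nat. interval_measure"
    by (rule product_sigma_finite_interval)
  interpret L: product_sigma_finite "\<lambda>_ :: nat. lborel :: real measure"
    by standard
  show ?thesis
  proof (rule I.PiM_eqI)
    show "sets (cube_measure M) = sets (Pi\<^sub>M {1..M} (\<lambda>_. interval_measure))"
      unfolding cube_measure_def by (simp cong: sets_PiM_cong)
    fix A :: "nat \<Rightarrow> real set"
    assume A: "\<And>i. i \<in> {1..M} \<Longrightarrow> A i \<in> sets interval_measure"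
    have "emeasure (cube_measure M) (Pi\<^sub>E {1..M} A) =
        emeasure (Pi\<^sub>M {1..M} (\<lambda>_. lborel :: real measure)) (Pi\<^sub>E {1..M} (\<lambda>i. {-1..1} \<inter> A i)) /
        emeasure (Pi\<^sub>M {1..M} (\<lambda>_. lborel :: real measure)) (Pi\<^sub>E {1..M} (\<lambda>_. {-1..1}))"
      unfolding cube_measure_def cube_def using A
      by (subst emeasure_uniform_measure) (auto simp: PiE_Int intro!: sets_PiM_I_finite)
    also have "\<dots> = (\<Prod>i\<in>{1..M}. emeasure lborel ({-1..1} \<inter> A i)) / (\<Prod>i\<in>{1..M}. 2)"
      using A by (subst (1 2) L.emeasure_PiM) auto
    also have "\<dots> = (\<Prod>i\<in>{1..M}. emeasure lborel ({-1..1} \<inter> A i) / 2)"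
      by (simp add: divide_ennreal_def prod.distrib ennreal_inverse_power)
    finally show "emeasure (cube_measure M) (Pi\<^sub>E {1..M} A) = (\<Prod>i\<in>{1..M}. emeasure interval_measure (A i))"
      using A by (simp add: emeasure_interval_measure)
  qed simp
qed

lemma prob_space_cube_measure: "prob_space (cube_measure M)"
  unfolding cube_measure_eq_PiM by (intro prob_space_PiM prob_space_interval_measure)

lemma sets_cube_measure [measurable_cong, simp]: "sets (cube_measure M) = sets (Pi\<^sub>M {1..M} (\<lambda>_. borel))"
  unfolding cube_measure_eq_PiM by (intro sets_PiM_cong) auto

lemma AE_cube_measure_cube: "AE y in cube_measure M. y \<in> cube M"
  unfolding cube_measure_def cube_def
  by (intro AE_uniform_measureI) (auto intro!: sets_PiM_I_finite)

lemma cube_eqI_interval: "y \<in> cube M \<Longrightarrow> k \<in> {1..M} \<Longrightarrow> y k \<in> {-1..1}"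
  unfolding cube_def by (rule PiE_mem)

text \<open>Boxes around points of the cube have positive measure. This allows almost everywhere bounds of
  continuous functions to be turned into bounds on the whole cube, boundary included.\<close>
lemma full_measure_dense_in_cube:
  assumes P: "AE y in cube_measure M. P y" and y0: "y0 \<in> cube M" and \<delta>: "0 < \<delta>"
  shows "\<exists>y\<in>cube M. P y \<and> (\<forall>k\<in>{1..M}. \<bar>y k - y0 k\<bar> \<le> \<delta>)"
proof (rule ccontr)
  assume neg: "\<not> ?thesis"
  interpret I: product_sigma_finite "\<lambda>_ :: nat. interval_measure"
    by (rule product_sigma_finite_interval)
  define B where "B = Pi\<^sub>E {1..M} (\<lambda>k. {y0 k - \<delta>..y0 k + \<delta>})"
  have B: "B \<in> sets (cube_measure M)"
    unfolding B_def by (auto intro!: sets_PiM_I_finite)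
  have "AE y in cube_measure M. y \<notin> B"
    using P AE_cube_measure_cube
  proof eventually_elim
    case (elim y)
    show ?case
    proof
      assume "y \<in> B"
      then have "\<forall>k\<in>{1..M}. \<bar>y k - y0 k\<bar> \<le> \<delta>"
        by (auto simp: B_def PiE_iff abs_le_iff algebra_simps)
      then show False using neg elim by blast
    qed
  qed
  then have "emeasure (cube_measure M) B = 0"
    using B by (subst (asm) AE_iff_measurable[of B]) (use sets.sets_into_space[OF B] in auto)
  moreover have "emeasure (cube_measure M) B = (\<Prod>k\<in>{1..M}. emeasure interval_measure {y0 k - \<delta>..y0 k + \<delta>})"
    unfolding cube_measure_eq_PiM B_def by (rule I.emeasure_PiM) auto
  moreover have "emeasure interval_measure {y0 k - \<delta>..y0 k + \<delta>} \<noteq> 0" if "k \<in> {1..M}" for k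
  proof -
    have k: "-1 \<le> y0 k" "y0 k \<le> 1" using cube_eqI_interval[OF y0 that] by auto
    have "{-1..1} \<inter> {y0 k - \<delta>..y0 k + \<delta>} = {max (-1) (y0 k - \<delta>)..min 1 (y0 k + \<delta>)}"
      by auto
    moreover have "max (-1) (y0 k - \<delta>) < min 1 (y0 k + \<delta>)" using k \<delta> by auto
    then have "emeasure lborel {max (-1) (y0 k - \<delta>)..min 1 (y0 k + \<delta>)} \<noteq> 0"
      by (subst emeasure_lborel_Icc) (auto simp only: order.strict_implies_order ennreal_eq_0_iff)
    ultimately show ?thesis
      by (simp add: emeasure_interval_measure ennreal_divide_eq_0_iff )
  qed
  ultimately show False by simp
qed

lemma poly_product_AE_bound:
  assumes AE: "AE y in cube_measure M. \<bar>\<Prod>k=1..M. poly (q k) (y k)\<bar> \<le> c" and y0: "y0 \<in> cube M"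
  shows "\<bar>\<Prod>k=1..M. poly (q k) (y0 k)\<bar> \<le> (c :: real)"
proof -
  have "\<exists>y. \<bar>\<Prod>k=1..M. poly (q k) (y k)\<bar> \<le> c \<and> (\<forall>k\<in>{1..M}. \<bar>y k - y0 k\<bar> \<le> 1 / real (Suc n))" for n
    using full_measure_dense_in_cube[OF AE y0, of "1 / real (Suc n)"] by auto
  then obtain y where y: "\<And>n. \<bar>\<Prod>k=1..M. poly (q k) (y n k)\<bar> \<le> c"
    "\<And>n k. k \<in> {1..M} \<Longrightarrow> \<bar>y n k - y0 k\<bar> \<le> 1 / real (Suc n)"
    by metis
  have "(\<lambda>n. y n k) \<longlonglongrightarrow> y0 k" if "k \<in> {1..M}" for k
  proof -
    have "(\<lambda>n. y n k - y0 k) \<longlonglongrightarrow> 0"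
      using y(2)[OF that] LIMSEQ_inverse_real_of_nat
      by (intro Lim_null_comparison[of "\<lambda>n. y n k - y0 k" "\<lambda>n. inverse (real (Suc n))"])
         (auto simp: inverse_eq_divide)
    then show ?thesis by (simp add: LIM_zero_iff)
  qed
  then have "(\<lambda>n. \<bar>\<Prod>k=1..M. poly (q k) (y n k)\<bar>) \<longlonglongrightarrow> \<bar>\<Prod>k=1..M. poly (q k) (y0 k)\<bar>"
    by (intro tendsto_intros) auto
  then show ?thesis
    using y(1) by (intro LIMSEQ_le_const2) auto
qed

lemma poly_product_bounded:
  obtains B where "0 \<le> B" "\<And>y. y \<in> cube M \<Longrightarrow> \<bar>\<Prod>k=1..M. poly (q k) (y k)\<bar> \<le> (B :: real)"
proof -
  have "\<exists>b. \<forall>x\<in>{-1..1::real}. \<bar>poly (q k) x\<bar> \<le> b" for k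
  proof -
    have "bounded (poly (q k) ` {-1..1})"
      by (intro compact_imp_bounded compact_continuous_image continuous_on_poly continuous_on_id) auto
    then show ?thesis unfolding bounded_iff by auto
  qed
  then obtain b where b: "\<And>k x. x \<in> {-1..1::real} \<Longrightarrow> \<bar>poly (q k) x\<bar> \<le> b k" by metis
  have b0: "0 \<le> b k" for k using b[of 0 k] by (simp add: order_trans[OF abs_ge_zero])
  show ?thesis
  proof (rule that[of "\<Prod>k=1..M. b k"])
    show "0 \<le> (\<Prod>k=1..M. b k)" using b0 by (intro prod_nonneg) auto
    fix y assume "y \<in> cube M"
    then show "\<bar>\<Prod>k=1..M. poly (q k) (y k)\<bar> \<le> (\<Prod>k=1..M. b k)"
      unfolding abs_prod using b cube_eqI_interval by (intro prod_mono) auto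
  qed
qed

lemma measurable_poly [measurable]: "poly p \<in> borel_measurable borel" for p :: "real poly"
  by (intro borel_measurable_continuous_onI continuous_intros)

lemma measurable_poly_product [measurable]:
  "(\<lambda>y. \<Prod>k=1..M. poly (q k) (y k) :: real) \<in> borel_measurable (cube_measure M)"
  by measurable

lemma integrable_poly_product: "integrable (cube_measure M) (\<lambda>y. \<Prod>k=1..M. poly (q k) (y k) :: real)"
proof -
  interpret prob_space "cube_measure M" by (rule prob_space_cube_measure)
  obtain B where B: "\<And>y. y \<in> cube M \<Longrightarrow> \<bar>\<Prod>k=1..M. poly (q k) (y k)\<bar> \<le> B"
    using poly_product_bounded by blast
  show ?thesis
  proof (rule integrable_const_bound)
    show "AE y in cube_measure M. norm (\<Prod>k=1..M. poly (q k) (y k)) \<le> B"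
      using AE_cube_measure_cube by eventually_elim (use B in auto)
  qed measurable
qed

lemma integral_poly_product:
  "(LINT y|cube_measure M. (\<Prod>k=1..M. poly (q k) (y k))) = (\<Prod>k=1..M. poly_mean (q k))"
proof -
  interpret I: product_sigma_finite "\<lambda>_ :: nat. interval_measure"
    by (rule product_sigma_finite_interval)
  show ?thesis
    unfolding cube_measure_eq_PiM poly_mean_def
    by (rule I.product_integral_prod) (auto intro: integrable_interval_measure_poly)
qed

lemma measurable_legendre [measurable]: "legendre M \<nu> \<in> borel_measurable (cube_measure M)"
  unfolding legendre_def by measurable

lemma legendre_orthonormal:
  assumes "\<mu> \<in> multi_index M" "\<nu> \<in> multi_index M"
  shows "(LINT y|cube_measure M. legendre M \<mu> y * legendre M \<nu> y) = (if \<mu> = \<nu> then 1 else 0)"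
proof -
  have "(LINT y|cube_measure M. legendre M \<mu> y * legendre M \<nu> y) =
      (\<Prod>k=1..M. if \<mu> k = \<nu> k then 1 else 0)"
    using integral_poly_product[of M "\<lambda>k. legendre_poly (\<mu> k) * legendre_poly (\<nu> k)"]
    by (simp add: legendre_def prod.distrib poly_mean_legendre)
  also have "\<dots> = (if \<mu> = \<nu> then 1 else 0)"
  proof (cases "\<mu> = \<nu>")
    case False
    then obtain k where "k \<in> {1..M}" "\<mu> k \<noteq> \<nu> k"
      using assms unfolding multi_index_def by (metis PiE_ext)
    then show ?thesis using False by (simp add: prod_zero_iff) (metis atLeastAtMost_iff)
  qed simp
  finally show ?thesis .
qed

lemma Linf_norm_legendre: "Linf_norm M (legendre M \<nu>) = ennreal (omega_low M \<nu>)"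
proof -
  obtain B where B: "0 \<le> B" "\<And>y. y \<in> cube M \<Longrightarrow> \<bar>legendre M \<nu> y\<bar> \<le> B"
    using poly_product_bounded[of M "\<lambda>k. legendre_poly (\<nu> k)"] unfolding legendre_def by blast
  have "Linf_norm M (legendre M \<nu>) \<le> ennreal B"
    unfolding Linf_norm_def
  proof (rule esssup_I)
    show "AE y in cube_measure M. ennreal \<bar>legendre M \<nu> y\<bar> \<le> ennreal B"
      using AE_cube_measure_cube by eventually_elim (use B in \<open>auto intro: ennreal_leI\<close>)
  qed measurable
  then have "Linf_norm M (legendre M \<nu>) < top"
    using order.strict_trans1 ennreal_less_top by blast
  then show ?thesis unfolding omega_low_def by simp
qed

lemma omega_low_nonneg: "0 \<le> omega_low M \<nu>"
  unfolding omega_low_def by simp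

lemma legendre_le_omega_low:
  assumes "y \<in> cube M"
  shows "\<bar>legendre M \<nu> y\<bar> \<le> omega_low M \<nu>"
proof -
  have "AE y in cube_measure M. ennreal \<bar>legendre M \<nu> y\<bar> \<le> ennreal (omega_low M \<nu>)"
    using esssup_AE[of "\<lambda>y. ennreal \<bar>legendre M \<nu> y\<bar>" "cube_measure M"]
    unfolding Linf_norm_legendre[symmetric] Linf_norm_def .
  then have "AE y in cube_measure M. \<bar>legendre M \<nu> y\<bar> \<le> omega_low M \<nu>"
    by eventually_elim (use omega_low_nonneg in \<open>simp add: ennreal_le_iff\<close>)
  then show ?thesis
    using poly_product_AE_bound[OF _ assms, where q = "\<lambda>k. legendre_poly (\<nu> k)"]
    unfolding legendre_def by blast
qed

lemma sqrt_le_omega_low: "(\<Prod>k=1..M. sqrt (2 * real (\<nu> k) + 1)) \<le> omega_low M \<nu>"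
proof -
  define y :: point where "y = (\<lambda>k\<in>{1..M}. 1)"
  have "y \<in> cube M" by (simp add: y_def cube_def)
  moreover have "legendre M \<nu> y = (\<Prod>k=1..M. sqrt (2 * real (\<nu> k) + 1))"
    by (simp add: legendre_def y_def poly_legendre_poly_1)
  ultimately show ?thesis using legendre_le_omega_low[of y M \<nu>] by simp
qed

text \<open>Evaluation at the corner \<open>(1, \<dots>, 1)\<close> bounds the sup norm from below. The resulting lower bound on
  the weights is what confines index sets of small total weight to the truncated range.\<close>
lemma omega_low_square_ge:
  assumes "k \<in> {1..M}"
  shows "2 * real (\<nu> k) + 1 \<le> (omega_low M \<nu>)\<^sup>2"
proof -
  have "sqrt (2 * real (\<nu> k) + 1) * 1 \<le> sqrt (2 * real (\<nu> k) + 1) * (\<Prod>j\<in>{1..M} - {k}. sqrt (2 * real (\<nu> j) + 1))"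
    by (intro mult_left_mono prod_ge_1) auto
  also have "\<dots> = (\<Prod>k=1..M. sqrt (2 * real (\<nu> k) + 1))"
    using prod.remove[OF finite_atLeastAtMost assms, of "\<lambda>k. sqrt (2 * real (\<nu> k) + 1)"] by simp
  finally have "sqrt (2 * real (\<nu> k) + 1) \<le> omega_low M \<nu>"
    using sqrt_le_omega_low[where \<nu> = \<nu> and M = M] by simp
  then have "(sqrt (2 * real (\<nu> k) + 1))\<^sup>2 \<le> (omega_low M \<nu>)\<^sup>2"
    by (intro power_mono) auto
  then show ?thesis by simp
qed

lemma omega_low_ge_1: "1 \<le> omega_low M \<nu>"
proof -
  have "1 \<le> (\<Prod>k=1..M. sqrt (2 * real (\<nu> k) + 1))" by (intro prod_ge_1) auto
  then show ?thesis using sqrt_le_omega_low by (rule order.trans)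
qed

lemma integrable_mult_legendre:
  assumes "integrable (cube_measure M) g"
  shows "integrable (cube_measure M) (\<lambda>y. g y * legendre M \<nu> y :: real)"
proof (rule Bochner_Integration.integrable_bound)
  have gm [measurable]: "g \<in> borel_measurable (cube_measure M)" using assms by auto
  show "(\<lambda>y. g y * legendre M \<nu> y) \<in> borel_measurable (cube_measure M)" by measurable
  show "integrable (cube_measure M) (\<lambda>y. omega_low M \<nu> * g y)" using assms by simp
  show "AE y in cube_measure M. norm (g y * legendre M \<nu> y) \<le> norm (omega_low M \<nu> * g y)"
    using AE_cube_measure_cube
  proof eventually_elim
    case (elim y)
    then show ?case
      using legendre_le_omega_low[OF elim, of \<nu>] omega_low_nonneg[of M \<nu>]
      by (simp add: abs_mult mult.commute[of "omega_low M \<nu>"] mult_left_mono)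
  qed
qed

section \<open>Completeness of the Legendre polynomials\<close>

lemma real_polynomial_function_poly:
  assumes "real_polynomial_function (f :: real \<Rightarrow> real)"
  obtains p where "f = poly p"
proof -
  obtain a n where f: "f = (\<lambda>x. \<Sum>i\<le>n. a i * x ^ i)"
    using assms unfolding real_polynomial_function_iff_sum by blast
  show ?thesis
    by (rule that[of "\<Sum>i\<le>n. monom (a i) i"]) (simp add: f fun_eq_iff poly_sum poly_monom)
qed

text \<open>The ramps \<open>h n\<close> decrease to the indicator function, and are replaced by polynomials with the
  Weierstrass theorem. Boundedness on \<open>{-1..1}\<close> makes dominated convergence applicable.\<close>
lemma poly_approx_indicator_atMost:
  fixes a :: real
  shows "\<exists>p. (\<forall>n. \<forall>x\<in>{-1..1}. \<bar>poly (p n) x\<bar> \<le> 2) \<and>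
             (\<forall>x\<in>{-1..1}. (\<lambda>n. poly (p n) x) \<longlonglongrightarrow> indicator {..a} x)"
proof -
  define h where "h = (\<lambda>n::nat. \<lambda>x. max 0 (min 1 (1 - real n * (x - a))))"
  have "\<exists>p. \<forall>x\<in>{-1..1}. \<bar>h n x - poly p x\<bar> < 1 / real (Suc n)" for n
  proof -
    have "continuous_on {-1..1} (h n)"
      unfolding h_def by (intro continuous_intros)
    then obtain g where g: "real_polynomial_function g" "\<And>x. x \<in> {-1..1} \<Longrightarrow> \<bar>h n x - g x\<bar> < 1 / real (Suc n)"
      using Stone_Weierstrass_real_polynomial_function[of "{-1..1::real}" "h n" "1 / real (Suc n)"] by auto
    obtain p where "g = poly p" using real_polynomial_function_poly[OF g(1)] .
    then show ?thesis using g(2) by (intro exI[of _ p]) auto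
  qed
  then obtain p where p: "\<And>n x. x \<in> {-1..1} \<Longrightarrow> \<bar>h n x - poly (p n) x\<bar> < 1 / real (Suc n)"
    by metis
  show ?thesis
  proof (intro exI[of _ p] conjI ballI allI)
    fix n and x :: real assume x: "x \<in> {-1..1}"
    have "\<bar>h n x\<bar> \<le> 1" by (auto simp: h_def)
    moreover have "1 / real (Suc n) \<le> 1" by simp
    ultimately show "\<bar>poly (p n) x\<bar> \<le> 2" using p[OF x, of n] by linarith
  next
    fix x :: real assume x: "x \<in> {-1..1}"
    have "(\<lambda>n. poly (p n) x - h n x) \<longlonglongrightarrow> 0"
    proof (rule Lim_null_comparison)
      show "\<forall>\<^sub>F n in sequentially. norm (poly (p n) x - h n x) \<le> inverse (real (Suc n))"
        using p[OF x] by (intro always_eventually allI) (simp add: inverse_eq_divide abs_minus_commute less_imp_le)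
    qed (rule LIMSEQ_inverse_real_of_nat)
    moreover have "(\<lambda>n. h n x) \<longlonglongrightarrow> indicator {..a} x"
    proof (cases "x \<le> a")
      case True
      then have "h n x = 1" for n
        by (simp add: h_def mult_nonneg_nonpos)
      then show ?thesis using True by simp
    next
      case False
      then obtain m where m: "1 < real m * (x - a)"
        using reals_Archimedean3[of "x - a"] by auto
      have "h n x = 0" if "m \<le> n" for n
      proof -
        have "real m * (x - a) \<le> real n * (x - a)" using that False by (intro mult_right_mono) auto
        then show ?thesis using m by (simp add: h_def)
      qed
      then have "\<forall>\<^sub>F n in sequentially. h n x = indicator {..a} x"
        using False by (auto simp: eventually_sequentially)
      then show ?thesis by (rule tendsto_eventually)
    qed
    ultimately have "(\<lambda>n. (poly (p n) x - h n x) + h n x) \<longlonglongrightarrow> 0 + indicator {..a} x"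
      by (rule tendsto_add)
    then show "(\<lambda>n. poly (p n) x) \<longlonglongrightarrow> indicator {..a} x" by simp
  qed
qed

text \<open>A coordinate half-space is the union of the lower orthants whose other bounds are a common natural
  number, since \<open>I\<close> is finite.\<close>
lemma sets_PiM_borel_eq_lower_orthants:
  fixes I :: "'i set"
  assumes "finite I"
  shows "sets (Pi\<^sub>M I (\<lambda>_. borel :: real measure)) =
     sigma_sets (I \<rightarrow>\<^sub>E UNIV) (range (\<lambda>a. Pi\<^sub>E I (\<lambda>k. {..a k})))" (is "_ = sigma_sets ?\<Omega> ?P")
proof
  have P: "?P \<subseteq> Pow ?\<Omega>" by (auto simp: PiE_iff)
  show "sigma_sets ?\<Omega> ?P \<subseteq> sets (Pi\<^sub>M I (\<lambda>_. borel :: real measure))"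
  proof -
    have "?P \<subseteq> sets (Pi\<^sub>M I (\<lambda>_. borel :: real measure))"
      using assms by (auto intro!: sets_PiM_I_finite)
    then show ?thesis
      using sets.sigma_sets_subset[of ?P "Pi\<^sub>M I (\<lambda>_. borel :: real measure)"] by (simp add: space_PiM)
  qed
  define N where "N = sigma ?\<Omega> ?P"
  have N: "space N = ?\<Omega>" "sets N = sigma_sets ?\<Omega> ?P"
    using P by (auto simp: N_def space_measure_of_conv sets_measure_of_conv)
  have "sets (Pi\<^sub>M I (\<lambda>_. borel :: real measure)) \<subseteq> sets N"
  proof (rule sets_PiM_in_sets)
    show "space N = (\<Pi>\<^sub>E i\<in>I. space (borel :: real measure))" by (simp add: N)
    fix i and A :: "real set" assume i: "i \<in> I" and A: "A \<in> sets borel"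
    have "(\<lambda>x. x i) \<in> borel_measurable N"
      unfolding borel_measurable_iff_le
    proof
      fix c :: real
      have "{x \<in> space N. x i \<le> c} = (\<Union>n::nat. Pi\<^sub>E I (\<lambda>k. {..if k = i then c else real n}))"
      proof safe
        fix x assume x: "x \<in> space N" "x i \<le> c"
        obtain n :: nat where n: "Max (x ` I) \<le> real n" using real_arch_simple by blast
        have "x k \<le> real n" if "k \<in> I" for k
          using n that assms by (meson Max_ge finite_imageI imageI order_trans)
        then have "x \<in> Pi\<^sub>E I (\<lambda>k. {..if k = i then c else real n})"
          using x by (auto simp: N PiE_iff)
        then show "x \<in> (\<Union>n::nat. Pi\<^sub>E I (\<lambda>k. {..if k = i then c else real n}))" by blast
      next
        fix x :: "'i \<Rightarrow> real" and n :: nat assume x: "x \<in> Pi\<^sub>E I (\<lambda>k. {..if k = i then c else real n})"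
        then show "x \<in> space N" by (auto simp: N PiE_iff)
        show "x i \<le> c" using PiE_mem[OF x i] by simp
      qed
      moreover have "Pi\<^sub>E I (\<lambda>k. {..if k = i then c else real n}) \<in> sets N" for n :: nat
        unfolding N by (intro sigma_sets.Basic range_eqI[where x = "\<lambda>k. if k = i then c else real n"]) simp
      ultimately show "{x \<in> space N. x i \<le> c} \<in> sets N" by (simp add: sets.countable_UN)
    qed
    then have "(\<lambda>x. x i) -` A \<inter> space N \<in> sets N" using A by (rule measurable_sets)
    moreover have "(\<lambda>x. x i) -` A \<inter> space N = {x \<in> space N. x i \<in> A}" by auto
    ultimately show "{x \<in> space N. x i \<in> A} \<in> sets N" by simp
  qed
  then show "sets (Pi\<^sub>M I (\<lambda>_. borel :: real measure)) \<subseteq> sigma_sets ?\<Omega> ?P" by (simp add: N)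
qed

text \<open>The indicator function of an orthant is a product of univariate ones, and hence a bounded pointwise
  limit of products of polynomials.\<close>
lemma integral_lower_orthant_zero:
  assumes g: "integrable (cube_measure M) g"
    and orth: "\<And>q. (LINT y|cube_measure M. g y * (\<Prod>k=1..M. poly (q k) (y k))) = 0"
  shows "(LINT y|cube_measure M. g y * indicator (Pi\<^sub>E {1..M} (\<lambda>k. {..a k})) y) = (0 :: real)"
proof -
  obtain p where p: "\<And>(c :: real) n (x :: real). x \<in> {-1..1} \<Longrightarrow> \<bar>poly (p c n) x\<bar> \<le> 2"
    "\<And>(c :: real) (x :: real). x \<in> {-1..1} \<Longrightarrow> (\<lambda>n. poly (p c n) x) \<longlonglongrightarrow> indicator {..c} x"
    using poly_approx_indicator_atMost by metis
  have gm [measurable]: "g \<in> borel_measurable (cube_measure M)" using g by auto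
  have "(\<lambda>n. LINT y|cube_measure M. g y * (\<Prod>k=1..M. poly (p (a k) n) (y k))) \<longlonglongrightarrow>
      (LINT y|cube_measure M. g y * indicator (Pi\<^sub>E {1..M} (\<lambda>k. {..a k})) y)"
  proof (rule integral_dominated_convergence[where w = "\<lambda>y. \<bar>g y\<bar> * 2 ^ M"])
    have "Pi\<^sub>E {1..M} (\<lambda>k. {..a k}) \<in> sets (cube_measure M)"
      by (auto intro!: sets_PiM_I_finite)
    then show "(\<lambda>y. g y * indicator (Pi\<^sub>E {1..M} (\<lambda>k. {..a k})) y) \<in> borel_measurable (cube_measure M)"
      by measurable
    show "integrable (cube_measure M) (\<lambda>y. \<bar>g y\<bar> * 2 ^ M)" using g by simp
    show "AE y in cube_measure M. (\<lambda>n. g y * (\<Prod>k=1..M. poly (p (a k) n) (y k))) \<longlonglongrightarrow>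
        g y * indicator (Pi\<^sub>E {1..M} (\<lambda>k. {..a k})) y"
      using AE_cube_measure_cube
    proof eventually_elim
      case (elim y)
      have "(\<lambda>n. \<Prod>k=1..M. poly (p (a k) n) (y k)) \<longlonglongrightarrow> (\<Prod>k=1..M. indicator {..a k} (y k))"
        using cube_eqI_interval[OF elim] by (intro tendsto_prod p(2)) auto
      also have "(\<Prod>k=1..M. indicator {..a k} (y k)) = (indicator (Pi\<^sub>E {1..M} (\<lambda>k. {..a k})) y :: real)"
      proof (cases "y \<in> Pi\<^sub>E {1..M} (\<lambda>k. {..a k})")
        case True
        then have "\<forall>k\<in>{1..M}. y k \<le> a k" by (auto simp: PiE_iff)
        then show ?thesis using True by (simp add: indicator_def)
      next
        case False
        then obtain k where "k \<in> {1..M}" "\<not> y k \<le> a k"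
          using elim by (auto simp: cube_def PiE_iff)
        then have "(\<Prod>k=1..M. indicator {..a k} (y k)) = (0 :: real)"
          by (intro prod_zero) (auto simp: indicator_def intro!: bexI[of _ k])
        then show ?thesis using False by simp
      qed
      finally show ?case by (intro tendsto_intros)
    qed
    show "AE y in cube_measure M. norm (g y * (\<Prod>k=1..M. poly (p (a k) n) (y k))) \<le> \<bar>g y\<bar> * 2 ^ M" for n
      using AE_cube_measure_cube
    proof eventually_elim
      case (elim y)
      have "\<bar>\<Prod>k=1..M. poly (p (a k) n) (y k)\<bar> \<le> (\<Prod>k=1..M. 2)"
        unfolding abs_prod using cube_eqI_interval[OF elim] by (intro prod_mono) (auto intro!: p(1))
      then show ?case by (simp add: abs_mult mult_left_mono)
    qed
  qed measurable
  then show ?thesis using orth by (simp add: LIMSEQ_const_iff)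
qed

text \<open>The positive and the negative part of \<open>g\<close> are densities of two finite measures which agree on lower
  orthants by the previous lemma, hence everywhere.\<close>
lemma orthogonal_to_polynomials_imp_zero:
  assumes g: "integrable (cube_measure M) g"
    and orth: "\<And>q. (LINT y|cube_measure M. g y * (\<Prod>k=1..M. poly (q k) (y k))) = 0"
  shows "AE y in cube_measure M. g y = (0 :: real)"
proof -
  interpret prob_space "cube_measure M" by (rule prob_space_cube_measure)
  have gm [measurable]: "g \<in> borel_measurable (cube_measure M)" using g by auto
  let ?pos = "\<lambda>y. ennreal (max 0 (g y))" and ?neg = "\<lambda>y. ennreal (max 0 (- g y))"
  let ?P = "range (\<lambda>a :: nat \<Rightarrow> real. Pi\<^sub>E {1..M} (\<lambda>k. {..a k}))"
  have ip: "integrable (cube_measure M) (\<lambda>y. max 0 (g y))" "integrable (cube_measure M) (\<lambda>y. max 0 (- g y))"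
    using g by (auto intro: Bochner_Integration.integrable_max)
  have fin: "(\<integral>\<^sup>+y. ?pos y \<partial>cube_measure M) \<noteq> \<infinity>"
    using ip(1) by (subst nn_integral_eq_integral) auto
  have dens: "emeasure (density (cube_measure M) (\<lambda>y. ennreal (max 0 (h y)))) A =
      ennreal (LINT y|cube_measure M. max 0 (h y) * indicator A y)"
    if h: "integrable (cube_measure M) h" and A: "A \<in> sets (cube_measure M)" for h :: "point \<Rightarrow> real" and A
  proof -
    have hm [measurable]: "h \<in> borel_measurable (cube_measure M)" using h by auto
    have "emeasure (density (cube_measure M) (\<lambda>y. ennreal (max 0 (h y)))) A =
        (\<integral>\<^sup>+y. ennreal (max 0 (h y) * indicator A y) \<partial>cube_measure M)"
      using A by (subst emeasure_density) (auto intro!: nn_integral_cong simp: indicator_def)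
    also have "\<dots> = ennreal (LINT y|cube_measure M. max 0 (h y) * indicator A y)"
      using h A by (intro nn_integral_eq_integral)
        (auto intro!: integrable_real_mult_indicator Bochner_Integration.integrable_max)
    finally show ?thesis .
  qed
  have "density (cube_measure M) ?pos = density (cube_measure M) ?neg"
  proof (rule measure_eqI_generator_eq[where E = ?P and A = "\<lambda>n. Pi\<^sub>E {1..M} (\<lambda>_. {..real n})" and \<Omega> = "{1..M} \<rightarrow>\<^sub>E UNIV"])
    show "Int_stable ?P"
    proof (rule Int_stableI)
      fix A B assume "A \<in> ?P" "B \<in> ?P"
      then obtain a b where ab: "A = Pi\<^sub>E {1..M} (\<lambda>k. {..a k})" "B = Pi\<^sub>E {1..M} (\<lambda>k. {..b k})" by blast
      have "A \<inter> B = Pi\<^sub>E {1..M} (\<lambda>k. {..min (a k) (b k)})"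
        unfolding ab PiE_Int by (intro PiE_cong) auto
      then show "A \<inter> B \<in> ?P" by (intro range_eqI[where x = "\<lambda>k. min (a k) (b k)"]) simp
    qed
    show "?P \<subseteq> Pow ({1..M} \<rightarrow>\<^sub>E UNIV)" by (auto simp: PiE_iff)
    show "sets (density (cube_measure M) ?pos) = sigma_sets ({1..M} \<rightarrow>\<^sub>E UNIV) ?P"
      "sets (density (cube_measure M) ?neg) = sigma_sets ({1..M} \<rightarrow>\<^sub>E UNIV) ?P"
      by (simp_all add: sets_PiM_borel_eq_lower_orthants)
    show "range (\<lambda>n. Pi\<^sub>E {1..M} (\<lambda>_. {..real n})) \<subseteq> ?P"
      by (intro image_subsetI range_eqI) (rule refl)
    show "(\<Union>n. Pi\<^sub>E {1..M} (\<lambda>_. {..real n})) = {1..M} \<rightarrow>\<^sub>E UNIV"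
    proof (intro equalityI subsetI)
      fix x :: point assume x: "x \<in> {1..M} \<rightarrow>\<^sub>E UNIV"
      obtain n :: nat where n: "Max (x ` {1..M}) \<le> real n" using real_arch_simple by blast
      have "x k \<le> real n" if "k \<in> {1..M}" for k
        using n that by (meson Max_ge finite_imageI finite_atLeastAtMost imageI order_trans)
      then have "x \<in> Pi\<^sub>E {1..M} (\<lambda>_. {..real n})" using x by (simp add: PiE_iff)
      then show "x \<in> (\<Union>n. Pi\<^sub>E {1..M} (\<lambda>_. {..real n}))" by blast
    next
      fix x :: point assume "x \<in> (\<Union>n. Pi\<^sub>E {1..M} (\<lambda>_. {..real n}))"
      then show "x \<in> {1..M} \<rightarrow>\<^sub>E UNIV" by (simp add: PiE_iff)
    qed
    show "emeasure (density (cube_measure M) ?pos) (Pi\<^sub>E {1..M} (\<lambda>_. {..real n})) \<noteq> \<infinity>" for n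
      by (subst dens) (auto intro!: g sets_PiM_I_finite)
    fix X assume "X \<in> ?P"
    then obtain a where a: "X = Pi\<^sub>E {1..M} (\<lambda>k. {..a k})" by blast
    have X: "X \<in> sets (cube_measure M)" unfolding a by (auto intro!: sets_PiM_I_finite)
    have "(LINT y|cube_measure M. max 0 (g y) * indicator X y) - (LINT y|cube_measure M. max 0 (- g y) * indicator X y) =
        (LINT y|cube_measure M. max 0 (g y) * indicator X y - max 0 (- g y) * indicator X y)"
      using ip X by (intro Bochner_Integration.integral_diff[symmetric] integrable_real_mult_indicator) auto
    also have "\<dots> = (LINT y|cube_measure M. g y * indicator X y)"
      by (intro Bochner_Integration.integral_cong) (auto simp: max_def indicator_def)
    also have "\<dots> = 0" unfolding a by (rule integral_lower_orthant_zero[OF g orth])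
    finally show "emeasure (density (cube_measure M) ?pos) X = emeasure (density (cube_measure M) ?neg) X"
      using dens[OF g X] dens[OF Bochner_Integration.integrable_minus[OF g] X] by simp
  qed
  then have "AE y in cube_measure M. ?pos y = ?neg y"
    using fin by (subst (asm) finite_density_unique) auto
  then show ?thesis by eventually_elim (auto simp: max_def split: if_splits)
qed

text \<open>Completeness of the Legendre system: \<open>L\<^sub>k\<close> has degree \<open>k\<close>, so products of univariate polynomials
  are finite combinations of tensor product Legendre polynomials.\<close>
lemma legendre_complete:
  assumes g: "integrable (cube_measure M) g"
    and orth: "\<And>\<nu>. \<nu> \<in> multi_index M \<Longrightarrow> (LINT y|cube_measure M. g y * legendre M \<nu> y) = 0"
  shows "AE y in cube_measure M. g y = (0 :: real)"
proof (rule orthogonal_to_polynomials_imp_zero[OF g])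
  fix q :: "nat \<Rightarrow> real poly"
  note il = integrable_mult_legendre[OF g]
  have "\<exists>a. q k = (\<Sum>j\<le>degree (q k). smult (a j) (legendre_poly j))" for k
    by (rule legendre_poly_span) simp
  then obtain a where a: "\<And>k. q k = (\<Sum>j\<le>degree (q k). smult (a k j) (legendre_poly j))"
    by metis
  have pq: "poly (q k) x = (\<Sum>j\<le>degree (q k). a k j * poly (legendre_poly j) x)" for k x
    by (subst a) (simp add: poly_sum)
  let ?B = "Pi\<^sub>E {1..M} (\<lambda>k. {..degree (q k)})"
  have fin: "finite ?B" by (intro finite_PiE) auto
  have "(\<Prod>k=1..M. poly (q k) (y k)) = (\<Sum>\<nu>\<in>?B. (\<Prod>k=1..M. a k (\<nu> k)) * legendre M \<nu> y)" for y
  proof -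
    have "(\<Prod>k=1..M. poly (q k) (y k)) =
        (\<Prod>k=1..M. \<Sum>j\<le>degree (q k). a k j * poly (legendre_poly j) (y k))"
      by (simp only: pq)
    also have "\<dots> = (\<Sum>\<nu>\<in>?B. \<Prod>k=1..M. a k (\<nu> k) * poly (legendre_poly (\<nu> k)) (y k))"
      by (rule prod_sum_PiE) auto
    finally show ?thesis by (simp add: legendre_def prod.distrib)
  qed
  then have "(LINT y|cube_measure M. g y * (\<Prod>k=1..M. poly (q k) (y k))) =
      (LINT y|cube_measure M. (\<Sum>\<nu>\<in>?B. (\<Prod>k=1..M. a k (\<nu> k)) * (g y * legendre M \<nu> y)))"
    by (simp add: sum_distrib_left mult_ac)
  also have "\<dots> = (\<Sum>\<nu>\<in>?B. (\<Prod>k=1..M. a k (\<nu> k)) * (LINT y|cube_measure M. g y * legendre M \<nu> y))"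
    using il by (subst Bochner_Integration.integral_sum) auto
  also have "\<dots> = 0"
    using orth by (intro sum.neutral) (auto simp: multi_index_def PiE_iff)
  finally show "(LINT y|cube_measure M. g y * (\<Prod>k=1..M. poly (q k) (y k))) = 0" .
qed

section \<open>Legendre expansions\<close>

lemma countable_multi_index: "countable (multi_index M)"
  unfolding multi_index_def by (intro countable_PiE) auto

lemma infinite_multi_index:
  assumes "1 \<le> M"
  shows "infinite (multi_index M)"
proof
  assume "finite (multi_index M)"
  moreover have "range (\<lambda>n. \<lambda>k\<in>{1..M}. n) \<subseteq> multi_index M" by (auto simp: multi_index_def)
  ultimately have "finite (range (\<lambda>n::nat. \<lambda>k\<in>{1..M}. n))" by (rule finite_subset[rotated])
  moreover have "inj (\<lambda>n::nat. \<lambda>k\<in>{1..M}. n)"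
    using assms by (auto intro!: injI dest: fun_cong[of _ _ 1])
  ultimately show False using finite_imageD by blast
qed

lemma integrable_legendre: "integrable (cube_measure M) (legendre M \<nu>)"
  unfolding legendre_def by (rule integrable_poly_product)

lemma integrable_legendre_mult: "integrable (cube_measure M) (\<lambda>y. legendre M \<mu> y * legendre M \<nu> y)"
  by (intro integrable_mult_legendre integrable_legendre)

lemma L2_integrable:
  assumes "z \<in> L2 M"
  shows "integrable (cube_measure M) z"
proof -
  interpret prob_space "cube_measure M" by (rule prob_space_cube_measure)
  show ?thesis using assms by (auto simp: L2_def intro: square_integrable_imp_integrable)
qed

text \<open>If the coefficients are absolutely summable against the sup norms, the Legendre series converges
  uniformly on the cube and may be integrated termwise. Its sum therefore has the same coefficients as
  \<open>z\<close>, and completeness identifies the two.\<close>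
lemma legendre_series_represents:
  assumes M: "1 \<le> M" and z: "z \<in> L2 M"
    and sm: "(\<lambda>\<nu>. \<bar>legendre_coeff M z \<nu>\<bar> * omega_low M \<nu>) summable_on multi_index M"
  shows "AE y in cube_measure M. ((\<lambda>\<nu>. legendre_coeff M z \<nu> * legendre M \<nu> y) has_sum z y) (multi_index M)"
proof -
  interpret prob_space "cube_measure M" by (rule prob_space_cube_measure)
  define c where "c = legendre_coeff M z"
  define e where "e = from_nat_into (multi_index M)"
  have e: "bij_betw e UNIV (multi_index M)"
    unfolding e_def by (rule bij_betw_from_nat_into[OF countable_multi_index infinite_multi_index[OF M]])
  then have eI: "e n \<in> multi_index M" for n by (auto simp: bij_betw_def)
  have sme: "summable (\<lambda>n. \<bar>c (e n)\<bar> * omega_low M (e n))"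
    using sm summable_on_reindex_bij_betw[OF e, of "\<lambda>\<nu>. \<bar>c \<nu>\<bar> * omega_low M \<nu>"]
    by (intro summable_on_imp_summable) (simp add: c_def)
  have le: "\<bar>c \<nu> * legendre M \<nu> y\<bar> \<le> \<bar>c \<nu>\<bar> * omega_low M \<nu>" if "y \<in> cube M" for y \<nu>
    using legendre_le_omega_low[OF that] by (simp add: abs_mult mult_left_mono)
  define h where "h = (\<lambda>y. \<Sum>n. c (e n) * legendre M (e n) y)"
  have sm1: "summable (\<lambda>n. \<bar>c (e n) * legendre M (e n) y\<bar>)" if "y \<in> cube M" for y
    using le[OF that] by (intro summable_comparison_test'[OF sme, of 0]) auto
  have hs: "((\<lambda>\<nu>. c \<nu> * legendre M \<nu> y) has_sum h y) (multi_index M)" if "y \<in> cube M" for y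
  proof -
    have "(\<lambda>n. c (e n) * legendre M (e n) y) sums h y"
      unfolding h_def using summable_rabs_cancel[OF sm1[OF that]] by (rule summable_sums)
    then have "((\<lambda>n. c (e n) * legendre M (e n) y) has_sum h y) UNIV"
      using sm1[OF that] by (intro norm_summable_imp_has_sum) auto
    then show ?thesis by (subst (asm) has_sum_reindex_bij_betw[OF e])
  qed
  have iL: "integrable (cube_measure M) (\<lambda>y. c \<nu> * legendre M \<nu> y)" for \<nu>
    by (intro Bochner_Integration.integrable_mult_right integrable_legendre)
  have int_le: "(LINT y|cube_measure M. norm (c \<nu> * legendre M \<nu> y * f y)) \<le> \<bar>c \<nu>\<bar> * omega_low M \<nu> * b"
    if f: "integrable (cube_measure M) (\<lambda>y. c \<nu> * legendre M \<nu> y * f y)" "\<And>y. y \<in> cube M \<Longrightarrow> \<bar>f y\<bar> \<le> b" for \<nu> f b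
  proof -
    have "(LINT y|cube_measure M. norm (c \<nu> * legendre M \<nu> y * f y)) \<le> (LINT y|cube_measure M. \<bar>c \<nu>\<bar> * omega_low M \<nu> * b)"
    proof (rule integral_mono_AE)
      show "AE y in cube_measure M. norm (c \<nu> * legendre M \<nu> y * f y) \<le> \<bar>c \<nu>\<bar> * omega_low M \<nu> * b"
        using AE_cube_measure_cube
      proof eventually_elim
        case (elim y)
        have "\<bar>c \<nu> * legendre M \<nu> y\<bar> * \<bar>f y\<bar> \<le> \<bar>c \<nu>\<bar> * omega_low M \<nu> * b"
          using le[OF elim] f(2)[OF elim] omega_low_nonneg[of M \<nu>] by (intro mult_mono) auto
        then show ?case by (simp add: abs_mult mult.assoc)
      qed
    qed (use f in auto)
    then show ?thesis using prob_space by simp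
  qed
  have ih: "integrable (cube_measure M) h"
    unfolding h_def
  proof (rule integrable_suminf)
    show "AE y in cube_measure M. summable (\<lambda>n. norm (c (e n) * legendre M (e n) y))"
      using AE_cube_measure_cube by eventually_elim (use sm1 in simp)
    show "summable (\<lambda>n. LINT y|cube_measure M. norm (c (e n) * legendre M (e n) y))"
    proof (rule summable_comparison_test'[OF sme, of 0])
      fix n
      have "(LINT y|cube_measure M. norm (c (e n) * legendre M (e n) y * 1)) \<le> \<bar>c (e n)\<bar> * omega_low M (e n) * 1"
        by (rule int_le) (use iL in simp_all)
      then show "norm (LINT y|cube_measure M. norm (c (e n) * legendre M (e n) y)) \<le> \<bar>c (e n)\<bar> * omega_low M (e n)"
        by simp
    qed
  qed (rule iL)
  have iLL: "integrable (cube_measure M) (\<lambda>y. c \<nu> * legendre M \<nu> y * legendre M \<mu> y)" for \<mu> \<nu>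
    using integrable_legendre_mult[of M \<nu> \<mu>] by (simp add: mult.assoc)
  have coeff: "(LINT y|cube_measure M. h y * legendre M \<mu> y) = c \<mu>" if \<mu>: "\<mu> \<in> multi_index M" for \<mu>
  proof -
    have "(LINT y|cube_measure M. h y * legendre M \<mu> y) =
        (LINT y|cube_measure M. (\<Sum>n. c (e n) * legendre M (e n) y * legendre M \<mu> y))"
    proof (rule integral_cong_AE)
      show "AE y in cube_measure M. h y * legendre M \<mu> y = (\<Sum>n. c (e n) * legendre M (e n) y * legendre M \<mu> y)"
        using AE_cube_measure_cube
      proof eventually_elim
        case (elim y)
        show ?case unfolding h_def
          by (rule suminf_mult2[OF summable_rabs_cancel[OF sm1[OF elim]]])
      qed
    qed (use ih in measurable)
    also have "\<dots> = (\<Sum>n. LINT y|cube_measure M. c (e n) * legendre M (e n) y * legendre M \<mu> y)"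
    proof (rule integral_suminf)
      show "AE y in cube_measure M. summable (\<lambda>n. norm (c (e n) * legendre M (e n) y * legendre M \<mu> y))"
        using AE_cube_measure_cube
      proof eventually_elim
        case (elim y)
        show ?case
          using summable_mult2[OF sm1[OF elim], of "\<bar>legendre M \<mu> y\<bar>"] by (simp add: abs_mult)
      qed
      show "summable (\<lambda>n. LINT y|cube_measure M. norm (c (e n) * legendre M (e n) y * legendre M \<mu> y))"
      proof (rule summable_comparison_test'[OF summable_mult2[OF sme, of "omega_low M \<mu>"], of 0])
        fix n
        have "(LINT y|cube_measure M. norm (c (e n) * legendre M (e n) y * legendre M \<mu> y)) \<le>
            \<bar>c (e n)\<bar> * omega_low M (e n) * omega_low M \<mu>"
          by (rule int_le[OF iLL legendre_le_omega_low])
        then show "norm (LINT y|cube_measure M. norm (c (e n) * legendre M (e n) y * legendre M \<mu> y)) \<le>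
            \<bar>c (e n)\<bar> * omega_low M (e n) * omega_low M \<mu>"
          by simp
      qed
    qed (rule iLL)
    also have "\<dots> = (\<Sum>n. if e n = \<mu> then c \<mu> else 0)"
      using legendre_orthonormal[OF eI \<mu>] by (intro suminf_cong) (simp add: mult.assoc)
    also have "\<dots> = c \<mu>"
    proof -
      obtain n0 where n0: "e n0 = \<mu>" using e \<mu> by (metis bij_betw_imp_surj_on imageE)
      have "e n = \<mu> \<longleftrightarrow> n = n0" for n
        using e n0 by (auto simp: bij_betw_def dest: injD)
      then show ?thesis using sums_unique[OF sums_single[of n0 "\<lambda>_. c \<mu>"]] by simp
    qed
    finally show ?thesis .
  qed
  have iz: "integrable (cube_measure M) z" using L2_integrable[OF z] .
  have "AE y in cube_measure M. z y - h y = 0"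
  proof (rule legendre_complete)
    show "integrable (cube_measure M) (\<lambda>y. z y - h y)" using iz ih by simp
    fix \<nu> assume \<nu>: "\<nu> \<in> multi_index M"
    have "(LINT y|cube_measure M. (z y - h y) * legendre M \<nu> y) =
        (LINT y|cube_measure M. z y * legendre M \<nu> y) - (LINT y|cube_measure M. h y * legendre M \<nu> y)"
      unfolding left_diff_distrib
      using iz ih by (intro Bochner_Integration.integral_diff integrable_mult_legendre)
    then show "(LINT y|cube_measure M. (z y - h y) * legendre M \<nu> y) = 0"
      using coeff[OF \<nu>] \<nu> by (simp add: c_def legendre_coeff_def)
  qed
  then show ?thesis
    using AE_cube_measure_cube
  proof eventually_elim
    case (elim y)
    then show ?case using hs[of y] by (simp add: c_def)
  qed
qed

lemma Linf_norm_legendre_tail: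
  assumes M: "1 \<le> M" and z: "z \<in> L2 M"
    and sm: "(\<lambda>\<nu>. \<bar>legendre_coeff M z \<nu>\<bar> * omega_low M \<nu>) summable_on multi_index M"
    and \<Lambda>: "finite \<Lambda>" "\<Lambda> \<subseteq> multi_index M"
  shows "Linf_norm M (\<lambda>y. z y - (\<Sum>\<nu>\<in>\<Lambda>. legendre_coeff M z \<nu> * legendre M \<nu> y)) \<le>
    ennreal (\<Sum>\<^sub>\<infinity>\<nu>\<in>multi_index M - \<Lambda>. \<bar>legendre_coeff M z \<nu>\<bar> * omega_low M \<nu>)"
  unfolding Linf_norm_def
proof (rule esssup_I)
  have zm [measurable]: "z \<in> borel_measurable (cube_measure M)" using z by (simp add: L2_def)
  show "(\<lambda>y. ennreal \<bar>z y - (\<Sum>\<nu>\<in>\<Lambda>. legendre_coeff M z \<nu> * legendre M \<nu> y)\<bar>) \<in> borel_measurable (cube_measure M)"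
    by measurable
  show "AE y in cube_measure M. ennreal \<bar>z y - (\<Sum>\<nu>\<in>\<Lambda>. legendre_coeff M z \<nu> * legendre M \<nu> y)\<bar> \<le>
      ennreal (\<Sum>\<^sub>\<infinity>\<nu>\<in>multi_index M - \<Lambda>. \<bar>legendre_coeff M z \<nu>\<bar> * omega_low M \<nu>)"
    using legendre_series_represents[OF M z sm] AE_cube_measure_cube
  proof eventually_elim
    case (elim y)
    have "((\<lambda>\<nu>. legendre_coeff M z \<nu> * legendre M \<nu> y) has_sum
        (z y - (\<Sum>\<nu>\<in>\<Lambda>. legendre_coeff M z \<nu> * legendre M \<nu> y))) (multi_index M - \<Lambda>)"
      using elim(1) \<Lambda> by (intro has_sum_Diff) auto
    moreover have "((\<lambda>\<nu>. \<bar>legendre_coeff M z \<nu>\<bar> * omega_low M \<nu>) has_sum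
        (\<Sum>\<^sub>\<infinity>\<nu>\<in>multi_index M - \<Lambda>. \<bar>legendre_coeff M z \<nu>\<bar> * omega_low M \<nu>)) (multi_index M - \<Lambda>)"
      by (intro has_sum_infsum summable_on_subset[OF sm]) auto
    ultimately have "norm (z y - (\<Sum>\<nu>\<in>\<Lambda>. legendre_coeff M z \<nu> * legendre M \<nu> y)) \<le>
        (\<Sum>\<^sub>\<infinity>\<nu>\<in>multi_index M - \<Lambda>. \<bar>legendre_coeff M z \<nu>\<bar> * omega_low M \<nu>)"
      by (rule norm_infsum_le)
         (use legendre_le_omega_low[OF elim(2)] in \<open>auto simp: abs_mult intro: mult_left_mono\<close>)
    then show ?case by (intro ennreal_leI) simp
  qed
qed

lemma legendre_sum_in_L2:
  assumes "finite \<Lambda>"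
  shows "(\<lambda>y. \<Sum>\<nu>\<in>\<Lambda>. c \<nu> * legendre M \<nu> y) \<in> L2 M"
proof -
  have "integrable (cube_measure M) (\<lambda>y. (\<Sum>\<nu>\<in>\<Lambda>. c \<nu> * legendre M \<nu> y)\<^sup>2)"
    unfolding power2_eq_square sum_product
    using integrable_legendre_mult
    by (intro Bochner_Integration.integrable_sum)
       (simp add: mult.assoc mult.left_commute[of "legendre M _ _"])
  then show ?thesis unfolding L2_def by simp
qed

lemma legendre_coeff_sum:
  assumes "finite \<Lambda>" "\<Lambda> \<subseteq> multi_index M"
  shows "legendre_coeff M (\<lambda>y. \<Sum>\<nu>\<in>\<Lambda>. c \<nu> * legendre M \<nu> y) =
    (\<lambda>\<mu>\<in>multi_index M. if \<mu> \<in> \<Lambda> then c \<mu> else 0)"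
  unfolding legendre_coeff_def
proof (rule restrict_ext)
  fix \<mu> assume \<mu>: "\<mu> \<in> multi_index M"
  have "(LINT y|cube_measure M. (\<Sum>\<nu>\<in>\<Lambda>. c \<nu> * legendre M \<nu> y) * legendre M \<mu> y) =
      (LINT y|cube_measure M. (\<Sum>\<nu>\<in>\<Lambda>. c \<nu> * (legendre M \<nu> y * legendre M \<mu> y)))"
    by (simp add: sum_distrib_right mult.assoc)
  also have "\<dots> = (\<Sum>\<nu>\<in>\<Lambda>. c \<nu> * (LINT y|cube_measure M. legendre M \<nu> y * legendre M \<mu> y))"
    using integrable_legendre_mult by (subst Bochner_Integration.integral_sum) auto
  also have "\<dots> = (\<Sum>\<nu>\<in>\<Lambda>. if \<nu> = \<mu> then c \<nu> else 0)"
    using legendre_orthonormal \<mu> assms(2) by (intro sum.cong) auto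
  also have "\<dots> = (if \<mu> \<in> \<Lambda> then c \<mu> else 0)"
    using assms(1) by simp
  finally show "(LINT y|cube_measure M. (\<Sum>\<nu>\<in>\<Lambda>. c \<nu> * legendre M \<nu> y) * legendre M \<mu> y) = (if \<mu> \<in> \<Lambda> then c \<mu> else 0)" .
qed

section \<open>Approximation rates\<close>

theorem mainTheorem3:
  fixes M :: nat and p :: real and \<omega> :: "(nat \<Rightarrow> nat) \<Rightarrow> real"
    and \<rho> :: "nat \<Rightarrow> real" and N :: "real \<Rightarrow> nat"
  assumes "1 \<le> M"
    and "0 < p" and "p < 1"
    and "\<forall>k\<in>{1..M}. 1 < \<rho> k"
    and "\<forall>\<nu>\<in>multi_index M. 0 < \<omega> \<nu>"
    and "in_lp (multi_index M) 1 (\<lambda>\<nu>. (omega_low M \<nu>)\<^sup>2 / \<omega> \<nu>)"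
    and "in_lp (multi_index M) 1 (\<lambda>\<nu>. \<omega> \<nu> powr ((2 - p) / p) / omega_up M \<rho> \<nu>)"
    and "linf_norm (multi_index M) (\<lambda>\<nu>. omega_low M \<nu> / \<omega> \<nu>) \<le> 1"
    and "\<forall>\<gamma>>0. real (N \<gamma>) \<ge> (radius p \<gamma> - 1) / 2"
  shows "\<forall>\<gamma>>0. \<forall>z\<in>S_space M p \<omega>.
      (INF v\<in>model2_fun M p \<omega> N \<gamma>. Linf_norm M (\<lambda>y. z y - v y))
        \<le> (INF v\<in>model1_fun M p \<omega> N \<gamma>. Linf_norm M (\<lambda>y. z y - v y)) \<and>
      (INF v\<in>model1_fun M p \<omega> N \<gamma>. Linf_norm M (\<lambda>y. z y - v y))
        \<le> linf_norm (multi_index M) (\<lambda>\<nu>. omega_low M \<nu> / \<omega> \<nu>)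
            * ennreal (\<gamma> * S_norm M p \<omega> z)"
proof (intro allI impI ballI conjI)
  fix \<gamma> z assume \<gamma>: "0 < (\<gamma> :: real)" and z: "z \<in> S_space M p \<omega>"
  show "(INF v\<in>model2_fun M p \<omega> N \<gamma>. Linf_norm M (\<lambda>y. z y - v y))
        \<le> (INF v\<in>model1_fun M p \<omega> N \<gamma>. Linf_norm M (\<lambda>y. z y - v y))"
    using subsetD[OF model1_subset_model2] unfolding model1_fun_def model2_fun_def
    by (intro INF_superset_mono) auto
  note M = assms(1) and p = assms(2,3)
  let ?I = "multi_index M"
  define c where "c = legendre_coeff M z"
  define R where "R = radius p \<gamma>"
  have R0: "0 < R" using \<gamma> by (simp add: R_def radius_def)
  have zL2: "z \<in> L2 M" using z by (simp add: S_space_def)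
  have \<omega>0: "0 < \<omega> \<nu>" if "\<nu> \<in> ?I" for \<nu> using assms(5) that by auto
  obtain C where C: "linf_norm ?I (\<lambda>\<nu>. omega_low M \<nu> / \<omega> \<nu>) = ennreal C" "0 \<le> C" "C \<le> 1"
    using assms(8) by (cases "linf_norm ?I (\<lambda>\<nu>. omega_low M \<nu> / \<omega> \<nu>)") (auto simp: top_unique)
  have low_le: "omega_low M \<nu> \<le> C * \<omega> \<nu>" if "\<nu> \<in> ?I" for \<nu>
  proof -
    have "ennreal \<bar>omega_low M \<nu> / \<omega> \<nu>\<bar> \<le> ennreal C"
      unfolding C(1)[symmetric] linf_norm_def using that by (rule SUP_upper)
    then have "\<bar>omega_low M \<nu> / \<omega> \<nu>\<bar> \<le> C" using C(2) by simp
    then show ?thesis using \<omega>0[OF that] omega_low_nonneg[of M \<nu>] by (simp add: field_simps)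
  qed
  have low_le': "omega_low M \<nu> \<le> \<omega> \<nu>" if "\<nu> \<in> ?I" for \<nu>
    using low_le[OF that] mult_right_mono[OF C(3), of "\<omega> \<nu>"] \<omega>0[OF that] by linarith
  \<comment> \<open>The norm of \<open>z\<close> as an unweighted norm for the measure with atoms \<open>\<omega>\<^sub>\<nu>\<^sup>2\<close>.\<close>
  have eq: "(\<bar>c \<nu>\<bar> / \<omega> \<nu>) powr p * (\<omega> \<nu>)\<^sup>2 = \<bar>\<omega> \<nu> powr ((2 - p) / p) * c \<nu>\<bar> powr p" if "\<nu> \<in> ?I" for \<nu>
  proof -
    have "\<bar>\<omega> \<nu> powr ((2 - p) / p) * c \<nu>\<bar> powr p = \<omega> \<nu> powr (2 - p) * \<bar>c \<nu>\<bar> powr p"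
      using p by (simp add: abs_mult powr_mult powr_powr)
    also have "\<omega> \<nu> powr (2 - p) = (\<omega> \<nu>)\<^sup>2 / \<omega> \<nu> powr p"
      using \<omega>0[OF that] by (simp add: powr_diff)
    finally show ?thesis using \<omega>0[OF that] by (simp add: powr_divide)
  qed
  have smp: "(\<lambda>\<nu>. (\<bar>c \<nu>\<bar> / \<omega> \<nu>) powr p * (\<omega> \<nu>)\<^sup>2) summable_on ?I"
  proof -
    have "(\<lambda>\<nu>. (\<bar>c \<nu>\<bar> / \<omega> \<nu>) powr p * (\<omega> \<nu>)\<^sup>2) summable_on ?I \<longleftrightarrow>
        (\<lambda>\<nu>. \<bar>\<omega> \<nu> powr ((2 - p) / p) * c \<nu>\<bar> powr p) summable_on ?I"
      by (rule summable_on_cong) (rule eq)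
    then show ?thesis using z by (simp add: S_space_def in_lp_def c_def)
  qed
  have norm_eq: "(\<Sum>\<^sub>\<infinity>\<nu>\<in>?I. (\<bar>c \<nu>\<bar> / \<omega> \<nu>) powr p * (\<omega> \<nu>)\<^sup>2) powr (1 / p) = S_norm M p \<omega> z"
    unfolding S_norm_def lp_norm_def c_def[symmetric]
    by (intro arg_cong[where f = "\<lambda>x. x powr (1 / p)"] infsum_cong) (rule eq)
  have w1: "1 \<le> (\<omega> \<nu>)\<^sup>2" if "\<nu> \<in> ?I" for \<nu>
    using order.trans[OF omega_low_ge_1 low_le'[OF that]] by (simp add: one_le_power)
  obtain \<Lambda> where \<Lambda>: "finite \<Lambda>" "\<Lambda> \<subseteq> ?I" "(\<Sum>\<nu>\<in>\<Lambda>. (\<omega> \<nu>)\<^sup>2) \<le> R"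
    "(\<lambda>\<nu>. \<bar>c \<nu>\<bar> / \<omega> \<nu> * (\<omega> \<nu>)\<^sup>2) summable_on (?I - \<Lambda>)"
    "(\<Sum>\<^sub>\<infinity>\<nu>\<in>?I - \<Lambda>. \<bar>c \<nu>\<bar> / \<omega> \<nu> * (\<omega> \<nu>)\<^sup>2) \<le> R powr (1 - 1 / p) * S_norm M p \<omega> z"
    unfolding norm_eq[symmetric]
    using weighted_stechkin[OF p R0 w1 _ smp] \<omega>0 by (metis (no_types, lifting) abs_ge_zero divide_nonneg_pos)
  have R\<gamma>: "R powr (1 - 1 / p) = \<gamma>"
  proof -
    have "0 < rate p" using p by (simp add: rate_def)
    moreover have "1 - 1 / p = - rate p" by (simp add: rate_def)
    ultimately show ?thesis using \<gamma> by (simp add: R_def radius_def powr_powr)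
  qed
  have cw: "\<bar>c \<nu>\<bar> / \<omega> \<nu> * (\<omega> \<nu>)\<^sup>2 = \<bar>c \<nu>\<bar> * \<omega> \<nu>" if "\<nu> \<in> ?I - \<Lambda>" for \<nu>
    using \<omega>0[of \<nu>] that by (simp add: power2_eq_square)
  have sm1: "(\<lambda>\<nu>. \<bar>c \<nu>\<bar> * \<omega> \<nu>) summable_on (?I - \<Lambda>)"
    using \<Lambda>(4) by (rule summable_on_cong[THEN iffD1, rotated]) (rule cw)
  have tail: "(\<Sum>\<^sub>\<infinity>\<nu>\<in>?I - \<Lambda>. \<bar>c \<nu>\<bar> * \<omega> \<nu>) \<le> \<gamma> * S_norm M p \<omega> z"
  proof -
    have "(\<Sum>\<^sub>\<infinity>\<nu>\<in>?I - \<Lambda>. \<bar>c \<nu>\<bar> / \<omega> \<nu> * (\<omega> \<nu>)\<^sup>2) = (\<Sum>\<^sub>\<infinity>\<nu>\<in>?I - \<Lambda>. \<bar>c \<nu>\<bar> * \<omega> \<nu>)"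
      by (rule infsum_cong) (rule cw)
    then show ?thesis using \<Lambda>(5) by (simp only: R\<gamma>)
  qed
  have sm2: "(\<lambda>\<nu>. \<bar>c \<nu>\<bar> * omega_low M \<nu>) summable_on (?I - \<Lambda>)"
    using low_le' omega_low_nonneg
    by (intro summable_on_comparison_test[OF sm1]) (auto intro: mult_left_mono)
  have sm: "(\<lambda>\<nu>. \<bar>c \<nu>\<bar> * omega_low M \<nu>) summable_on ?I"
  proof -
    have "(\<lambda>\<nu>. \<bar>c \<nu>\<bar> * omega_low M \<nu>) summable_on (\<Lambda> \<union> (?I - \<Lambda>))"
      using \<Lambda>(1) sm2 by (intro summable_on_Un_disjoint) auto
    moreover have "\<Lambda> \<union> (?I - \<Lambda>) = ?I" using \<Lambda>(2) by auto
    ultimately show ?thesis by simp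
  qed
  define v where "v = (\<lambda>y. \<Sum>\<nu>\<in>\<Lambda>. c \<nu> * legendre M \<nu> y)"
  have cv: "legendre_coeff M v = (\<lambda>\<mu>\<in>?I. if \<mu> \<in> \<Lambda> then c \<mu> else 0)"
    unfolding v_def by (rule legendre_coeff_sum[OF \<Lambda>(1,2)])
  have "in_lp ?I p (\<lambda>\<nu>. \<omega> \<nu> powr ((2 - p) / p) * legendre_coeff M v \<nu>)"
  proof -
    have "(\<lambda>\<nu>. \<bar>\<omega> \<nu> powr ((2 - p) / p) * legendre_coeff M v \<nu>\<bar> powr p) summable_on ?I \<longleftrightarrow>
        (\<lambda>\<nu>. \<bar>\<omega> \<nu> powr ((2 - p) / p) * legendre_coeff M v \<nu>\<bar> powr p) summable_on \<Lambda>"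
      using \<Lambda>(2) by (intro summable_on_cong_neutral) (auto simp: cv)
    then show ?thesis unfolding in_lp_def using \<Lambda>(1) by simp
  qed
  then have vS: "v \<in> S_space M p \<omega>"
    using legendre_sum_in_L2[OF \<Lambda>(1)] by (simp add: S_space_def v_def)
  \<comment> \<open>For \<open>\<nu> \<in> \<Lambda>\<close>, the single mass \<open>\<omega>\<^sub>\<nu>\<^sup>2\<close> is at most \<open>R\<close> and at least \<open>2 \<nu>\<^sub>k + 1\<close>.\<close>
  have "\<Lambda> \<subseteq> full_idx M (N \<gamma> + 1)"
  proof
    fix \<nu> assume \<nu>: "\<nu> \<in> \<Lambda>"
    then have \<nu>I: "\<nu> \<in> ?I" using \<Lambda>(2) by auto
    have "\<nu> k < N \<gamma> + 1" if k: "k \<in> {1..M}" for k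
    proof -
      have "2 * real (\<nu> k) + 1 \<le> (omega_low M \<nu>)\<^sup>2" using omega_low_square_ge[OF k] .
      also have "\<dots> \<le> (\<omega> \<nu>)\<^sup>2" using low_le'[OF \<nu>I] omega_low_nonneg by (intro power_mono)
      also have "\<dots> \<le> (\<Sum>\<nu>\<in>\<Lambda>. (\<omega> \<nu>)\<^sup>2)" using \<Lambda>(1) \<nu> by (intro member_le_sum) auto
      also have "\<dots> \<le> R" by (rule \<Lambda>(3))
      finally have "real (\<nu> k) \<le> (R - 1) / 2" by simp
      also have "\<dots> \<le> real (N \<gamma>)" using assms(9) \<gamma> by (simp add: R_def)
      finally show ?thesis by simp
    qed
    then show "\<nu> \<in> full_idx M (N \<gamma> + 1)"
      using \<nu>I by (auto simp: full_idx_def multi_index_def PiE_iff)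
  qed
  then have "legendre_coeff M v \<in> model1 M (N \<gamma> + 1) R \<omega>"
    using \<Lambda> by (intro sparse_tensor_in_model1[where \<Lambda> = \<Lambda>]) (auto simp: cv)
  then have "v \<in> model1_fun M p \<omega> N \<gamma>"
    using vS by (simp add: model1_fun_def R_def)
  then have "(INF v\<in>model1_fun M p \<omega> N \<gamma>. Linf_norm M (\<lambda>y. z y - v y)) \<le> Linf_norm M (\<lambda>y. z y - v y)"
    by (rule INF_lower)
  also have "\<dots> \<le> ennreal (\<Sum>\<^sub>\<infinity>\<nu>\<in>?I - \<Lambda>. \<bar>c \<nu>\<bar> * omega_low M \<nu>)"
    unfolding v_def c_def
    by (rule Linf_norm_legendre_tail[OF M zL2 sm[unfolded c_def] \<Lambda>(1,2)])
  also have "\<dots> \<le> ennreal (C * (\<gamma> * S_norm M p \<omega> z))"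
  proof (rule ennreal_leI)
    have "(\<Sum>\<^sub>\<infinity>\<nu>\<in>?I - \<Lambda>. \<bar>c \<nu>\<bar> * omega_low M \<nu>) \<le> (\<Sum>\<^sub>\<infinity>\<nu>\<in>?I - \<Lambda>. C * (\<bar>c \<nu>\<bar> * \<omega> \<nu>))"
    proof (intro infsum_mono sm2 summable_on_cmult_right sm1)
      fix \<nu> assume "\<nu> \<in> ?I - \<Lambda>"
      then show "\<bar>c \<nu>\<bar> * omega_low M \<nu> \<le> C * (\<bar>c \<nu>\<bar> * \<omega> \<nu>)"
        using mult_left_mono[OF low_le, of \<nu> "\<bar>c \<nu>\<bar>"] by (simp add: mult.left_commute)
    qed
    also have "\<dots> = C * (\<Sum>\<^sub>\<infinity>\<nu>\<in>?I - \<Lambda>. \<bar>c \<nu>\<bar> * \<omega> \<nu>)"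
      by (rule infsum_cmult_right) (rule sm1)
    also have "\<dots> \<le> C * (\<gamma> * S_norm M p \<omega> z)" using tail C(2) by (rule mult_left_mono)
    finally show "(\<Sum>\<^sub>\<infinity>\<nu>\<in>?I - \<Lambda>. \<bar>c \<nu>\<bar> * omega_low M \<nu>) \<le> C * (\<gamma> * S_norm M p \<omega> z)" .
  qed
  also have "\<dots> = linf_norm ?I (\<lambda>\<nu>. omega_low M \<nu> / \<omega> \<nu>) * ennreal (\<gamma> * S_norm M p \<omega> z)"
    unfolding C(1) using C(2) \<gamma> by (intro ennreal_mult) (simp_all add: S_norm_def lp_norm_def)
  finally show "(INF v\<in>model1_fun M p \<omega> N \<gamma>. Linf_norm M (\<lambda>y. z y - v y))
        \<le> linf_norm ?I (\<lambda>\<nu>. omega_low M \<nu> / \<omega> \<nu>) * ennreal (\<gamma> * S_norm M p \<omega> z)" .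
qed

end
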